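(* Let $G$ be a finite group with pairwise non-isomorphic irreducible complex representations $(V_1,\rho_1),\dots,(V_k,\rho_k)$, and let $X$ be a $G$-homogeneous space (a finite set with a transitive $G$-action). Let $Q$ be a probability distribution on $G$ and put $q:=\sum_{g\in G}Q(g)e_g\in\mathbb{C}G$. Then \[\frac{1}{|X|}\sum_{x\in X}\|q\cdot e_{x}-\overline{u}\|_{\rm TV}^2\leq \frac{1}{4}\sum_{V_j\neq {\rm triv}} m(V_j, \mathbb{C} X) \|\hat{Q}(\rho_j)\|_{\rm Fb}^2\] and \[\frac{1}{|X|}\sum_{x\in X}\|q\cdot e_{x}-\overline{u}\|_{\rm TV}^2 \geq \frac{1}{4|X|}\sum_{V_j\neq {\rm triv}} m(V_j, \mathbb{C} X) \|\hat{Q}(\rho_j)\|_{\rm Fb}^2,\] where the sums run over the nontrivial irreducible representations. If furthermore $\|q\cdot e_{x}\|_2$ is independent of $x\in X$, then for every $x\in X$ \[\frac{1}{4|X|}\sum_{V_j\neq {\rm triv}} m(V_j, \mathbb{C} X) \|\hat{Q}(\rho_j)\|_{\rm Fb}^2\leq \|q\cdot e_{x}-\overline{u}\|_{\rm TV}^2\leq \frac{1}{4}\sum_{V_j\neq {\rm triv}} m(V_j, \mathbb{C} X) \|\hat{Q}(\rho_j)\|_{\rm Fb}^2.\]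
   Context: $\mathbb{C}G$ is the group algebra with basis $\{e_g\}_{g\in G}$ and product $e_ge_h=e_{gh}$. $\mathbb{C}X$ is the complex vector space with basis $\{e_x:x\in X\}$, made into a $\mathbb{C}G$-module by $e_g\cdot e_x:=e_{g(x)}$ extended linearly; so $q\cdot e_x=\sum_{g}Q(g)e_{g(x)}$. Elements $h=\sum_x h(x)e_x$ of $\mathbb{C}X$ have $\|h\|_{\rm TV}:=\frac12\sum_x|h(x)|$ and $\|h\|_2:=(\sum_x|h(x)|^2)^{1/2}$. $\overline{u}:=\frac{1}{|X|}\sum_{x\in X}e_x$. $m(V_j,\mathbb{C}X)$ is the multiplicity of $V_j$ in the decomposition of the representation $\mathbb{C}X$ into irreducibles. Each $V_j$ is equipped with a $G$-invariant Hermitian inner product and a fixed orthonormal basis $B_j$; the Fourier transform of $Q$ at $\rho_j$ is the matrix $\hat{Q}(\rho_j):=\sum_{g\in G}Q(g)[\rho_j(g)]_{B_j}$. For a matrix $A$, $\|A\|_{\rm Fb}^2:={\rm Tr}(AA^* )$. *)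

theory Defs
  imports "HOL-Algebra.Group_Action" "HOL-Analysis.Analysis" "HOL-Library.Function_Algebras"
begin

definition csmult :: "complex \<Rightarrow> ('i \<Rightarrow> complex) \<Rightarrow> ('i \<Rightarrow> complex)" where
  "csmult c v = (\<lambda>i. c * v i)"

definition csubspace :: "('i \<Rightarrow> complex) set \<Rightarrow> bool" where
  "csubspace W \<longleftrightarrow> 0 \<in> W \<and> (\<forall>u\<in>W. \<forall>v\<in>W. u + v \<in> W) \<and> (\<forall>c. \<forall>v\<in>W. csmult c v \<in> W)"

definition clinear_on :: "('i \<Rightarrow> complex) set \<Rightarrow> (('i \<Rightarrow> complex) \<Rightarrow> ('j \<Rightarrow> complex)) \<Rightarrow> bool" where
  "clinear_on V f \<longleftrightarrow> (\<forall>u\<in>V. \<forall>v\<in>V. f (u + v) = f u + f v) \<and> (\<forall>c. \<forall>v\<in>V. f (csmult c v) = csmult c (f v))"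

definition vecs :: "'i set \<Rightarrow> ('i \<Rightarrow> complex) set" where
  "vecs I = {v. \<forall>i. i \<notin> I \<longrightarrow> v i = 0}"

definition is_rep :: "'g monoid \<Rightarrow> ('i \<Rightarrow> complex) set \<Rightarrow> ('g \<Rightarrow> ('i \<Rightarrow> complex) \<Rightarrow> ('i \<Rightarrow> complex)) \<Rightarrow> bool" where
  "is_rep G V T \<longleftrightarrow> csubspace V
     \<and> (\<forall>g\<in>carrier G. clinear_on V (T g) \<and> T g ` V \<subseteq> V)
     \<and> (\<forall>v\<in>V. T \<one>\<^bsub>G\<^esub> v = v)
     \<and> (\<forall>g\<in>carrier G. \<forall>h\<in>carrier G. \<forall>v\<in>V. T (g \<otimes>\<^bsub>G\<^esub> h) v = T g (T h v))"

definition invariant_subspace :: "'g monoid \<Rightarrow> ('i \<Rightarrow> complex) set \<Rightarrow> ('g \<Rightarrow> ('i \<Rightarrow> complex) \<Rightarrow> ('i \<Rightarrow> complex)) \<Rightarrow> ('i \<Rightarrow> complex) set \<Rightarrow> bool" where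
  "invariant_subspace G V T W \<longleftrightarrow> csubspace W \<and> W \<subseteq> V \<and> (\<forall>g\<in>carrier G. T g ` W \<subseteq> W)"

definition irreducible_rep :: "'g monoid \<Rightarrow> ('i \<Rightarrow> complex) set \<Rightarrow> ('g \<Rightarrow> ('i \<Rightarrow> complex) \<Rightarrow> ('i \<Rightarrow> complex)) \<Rightarrow> bool" where
  "irreducible_rep G V T \<longleftrightarrow> is_rep G V T \<and> V \<noteq> {0}
     \<and> (\<forall>W. invariant_subspace G V T W \<longrightarrow> W = {0} \<or> W = V)"

definition rep_iso :: "'g monoid \<Rightarrow> ('i \<Rightarrow> complex) set \<Rightarrow> ('g \<Rightarrow> ('i \<Rightarrow> complex) \<Rightarrow> ('i \<Rightarrow> complex))
     \<Rightarrow> ('j \<Rightarrow> complex) set \<Rightarrow> ('g \<Rightarrow> ('j \<Rightarrow> complex) \<Rightarrow> ('j \<Rightarrow> complex)) \<Rightarrow> bool" where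
  "rep_iso G V T V' T' \<longleftrightarrow> (\<exists>f. bij_betw f V V' \<and> clinear_on V f
      \<and> (\<forall>g\<in>carrier G. \<forall>v\<in>V. f (T g v) = T' g (f v)))"

definition irred_decomp :: "'g monoid \<Rightarrow> ('i \<Rightarrow> complex) set \<Rightarrow> ('g \<Rightarrow> ('i \<Rightarrow> complex) \<Rightarrow> ('i \<Rightarrow> complex))
     \<Rightarrow> ('i \<Rightarrow> complex) set list \<Rightarrow> bool" where
  "irred_decomp G V T Ws \<longleftrightarrow>
     (\<forall>W\<in>set Ws. invariant_subspace G V T W \<and> irreducible_rep G W T)
     \<and> (\<forall>v\<in>V. \<exists>!ws. length ws = length Ws \<and> (\<forall>i<length Ws. ws ! i \<in> Ws ! i) \<and> v = sum_list ws)"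

definition multiplicity :: "'g monoid \<Rightarrow> ('j \<Rightarrow> complex) set \<Rightarrow> ('g \<Rightarrow> ('j \<Rightarrow> complex) \<Rightarrow> ('j \<Rightarrow> complex))
     \<Rightarrow> ('i \<Rightarrow> complex) set \<Rightarrow> ('g \<Rightarrow> ('i \<Rightarrow> complex) \<Rightarrow> ('i \<Rightarrow> complex)) \<Rightarrow> nat" where
  "multiplicity G U S V T =
     length (filter (\<lambda>W. rep_iso G W T U S) (SOME Ws. irred_decomp G V T Ws))"

text \<open>A d x d complex matrix is a function nat \<Rightarrow> nat \<Rightarrow> complex (entries with
indices \<ge> d are irrelevant). It acts on \<complex>^d = vecs {..<d}.\<close>
definition mat_act :: "nat \<Rightarrow> (nat \<Rightarrow> nat \<Rightarrow> complex) \<Rightarrow> (nat \<Rightarrow> complex) \<Rightarrow> (nat \<Rightarrow> complex)" where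
  "mat_act d M v = (\<lambda>i. if i < d then (\<Sum>j<d. M i j * v j) else 0)"

definition unitary_mat :: "nat \<Rightarrow> (nat \<Rightarrow> nat \<Rightarrow> complex) \<Rightarrow> bool" where
  "unitary_mat d M \<longleftrightarrow> (\<forall>i<d. \<forall>l<d. (\<Sum>m<d. M i m * cnj (M l m)) = (if i = l then 1 else 0))"

text \<open>A unitary matrix representation of dimension d: the matrix of the action in
an orthonormal basis for a G-invariant Hermitian inner product.\<close>
definition unitary_mat_rep :: "'g monoid \<Rightarrow> nat \<Rightarrow> ('g \<Rightarrow> nat \<Rightarrow> nat \<Rightarrow> complex) \<Rightarrow> bool" where
  "unitary_mat_rep G d \<rho> \<longleftrightarrow> 0 < d
     \<and> (\<forall>g\<in>carrier G. unitary_mat d (\<rho> g))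
     \<and> (\<forall>i<d. \<forall>j<d. \<rho> \<one>\<^bsub>G\<^esub> i j = (if i = j then 1 else 0))
     \<and> (\<forall>g\<in>carrier G. \<forall>h\<in>carrier G. \<forall>i<d. \<forall>j<d.
          \<rho> (g \<otimes>\<^bsub>G\<^esub> h) i j = (\<Sum>m<d. \<rho> g i m * \<rho> h m j))"

definition mat_rep_action :: "nat \<Rightarrow> ('g \<Rightarrow> nat \<Rightarrow> nat \<Rightarrow> complex) \<Rightarrow> 'g \<Rightarrow> (nat \<Rightarrow> complex) \<Rightarrow> (nat \<Rightarrow> complex)" where
  "mat_rep_action d \<rho> g = mat_act d (\<rho> g)"

definition trivial_mat_rep :: "'g monoid \<Rightarrow> nat \<Rightarrow> ('g \<Rightarrow> nat \<Rightarrow> nat \<Rightarrow> complex) \<Rightarrow> bool" where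
  "trivial_mat_rep G d \<rho> \<longleftrightarrow> d = 1 \<and> (\<forall>g\<in>carrier G. \<rho> g 0 0 = 1)"

definition fourier :: "'g monoid \<Rightarrow> ('g \<Rightarrow> real) \<Rightarrow> ('g \<Rightarrow> nat \<Rightarrow> nat \<Rightarrow> complex) \<Rightarrow> nat \<Rightarrow> nat \<Rightarrow> complex" where
  "fourier G Q \<rho> = (\<lambda>i j. \<Sum>g\<in>carrier G. complex_of_real (Q g) * \<rho> g i j)"

definition frob_sq :: "nat \<Rightarrow> (nat \<Rightarrow> nat \<Rightarrow> complex) \<Rightarrow> real" where
  "frob_sq d A = (\<Sum>i<d. \<Sum>l<d. (cmod (A i l))\<^sup>2)"

definition basis_vec :: "'x \<Rightarrow> 'x \<Rightarrow> complex" where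
  "basis_vec x = (\<lambda>y. if y = x then 1 else 0)"

text \<open>\<open>e_g \<cdot> (\<Sum>_x h(x) e_x) = \<Sum>_x h(x) e_{g(x)}\<close>.\<close>
definition perm_act :: "'x set \<Rightarrow> ('g \<Rightarrow> 'x \<Rightarrow> 'x) \<Rightarrow> 'g \<Rightarrow> ('x \<Rightarrow> complex) \<Rightarrow> ('x \<Rightarrow> complex)" where
  "perm_act X \<phi> g h = (\<lambda>y. \<Sum>x\<in>X. if \<phi> g x = y then h x else 0)"

definition alg_act :: "'g monoid \<Rightarrow> 'x set \<Rightarrow> ('g \<Rightarrow> 'x \<Rightarrow> 'x) \<Rightarrow> ('g \<Rightarrow> real) \<Rightarrow> ('x \<Rightarrow> complex) \<Rightarrow> ('x \<Rightarrow> complex)" where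
  "alg_act G X \<phi> Q h = (\<lambda>y. \<Sum>g\<in>carrier G. complex_of_real (Q g) * perm_act X \<phi> g h y)"

definition unif :: "'x set \<Rightarrow> 'x \<Rightarrow> complex" where
  "unif X = (\<lambda>y. if y \<in> X then 1 / of_nat (card X) else 0)"

definition tv_norm :: "'x set \<Rightarrow> ('x \<Rightarrow> complex) \<Rightarrow> real" where
  "tv_norm X h = (1/2) * (\<Sum>x\<in>X. cmod (h x))"

definition l2_norm :: "'x set \<Rightarrow> ('x \<Rightarrow> complex) \<Rightarrow> real" where
  "l2_norm X h = sqrt (\<Sum>x\<in>X. (cmod (h x))\<^sup>2)"

end

theory Submission
  imports Defs
begin

text \<open>Counting fixed points gives \<open>\<Sum>\<^sub>x \<parallel>q \<cdot> e\<^sub>x\<parallel>\<^sub>2\<^sup>2 = \<Sum>\<^sub>g \<Sum>\<^sub>h Q(g) Q(h) \<chi>\<^sub>X(h\<^sup>-\<^sup>1 g)\<close>, and for a unitary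
  representation \<open>\<parallel>\<rho>(Q)\<parallel>\<^sup>2 = \<Sum>\<^sub>g \<Sum>\<^sub>h Q(g) Q(h) \<chi>\<^sub>\<rho>(h\<^sup>-\<^sup>1 g)\<close> in the Frobenius norm. Decomposing the character
  \<open>\<chi>\<^sub>X\<close> of \<open>\<complex>X\<close> into irreducible characters yields
  \<open>\<Sum>\<^sub>x \<parallel>q \<cdot> e\<^sub>x\<parallel>\<^sub>2\<^sup>2 = \<Sum>\<^sub>j m\<^sub>j \<parallel>\<rho>\<^sub>j(Q)\<parallel>\<^sup>2\<close>. The trivial representation contributes \<open>1\<close>, which is also the total
  loss when \<open>u\<close> is subtracted from each \<open>q \<cdot> e\<^sub>x\<close>. Finally \<open>\<parallel>h\<parallel>\<^sub>2\<^sup>2 \<le> 4 \<parallel>h\<parallel>\<^sub>T\<^sub>V\<^sup>2 \<le> |X| \<parallel>h\<parallel>\<^sub>2\<^sup>2\<close>.\<close>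

section \<open>Linear algebra in spaces of complex functions\<close>

lemma sum_fun_apply: "(\<Sum>a\<in>A. f a) x = (\<Sum>a\<in>A. f a x)"
  for f :: "'a \<Rightarrow> 'b \<Rightarrow> 'c::comm_monoid_add"
  by (induction A rule: infinite_finite_induct) auto

text \<open>The ambient vector space is the full type of functions; representation spaces are
  subspaces of it. This makes span, independence and dimension available for them.\<close>

interpretation cvec: vector_space csmult
  by unfold_locales (auto simp: csmult_def fun_eq_iff algebra_simps)

interpretation cvec_pair: vector_space_pair csmult csmult ..

lemma csubspace_iff: "csubspace V \<longleftrightarrow> cvec.subspace V"
  by (simp add: csubspace_def cvec.subspace_def)

lemma csubspace_zero: "csubspace V \<Longrightarrow> 0 \<in> V"
  and csubspace_add: "csubspace V \<Longrightarrow> u \<in> V \<Longrightarrow> v \<in> V \<Longrightarrow> u + v \<in> V"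
  and csubspace_csmult: "csubspace V \<Longrightarrow> v \<in> V \<Longrightarrow> csmult c v \<in> V"
  by (auto simp: csubspace_def)

lemma csubspace_diff: "csubspace V \<Longrightarrow> u \<in> V \<Longrightarrow> v \<in> V \<Longrightarrow> u - v \<in> V"
  by (simp add: csubspace_iff cvec.subspace_diff)

lemma csubspace_sum: "csubspace V \<Longrightarrow> (\<And>a. a \<in> A \<Longrightarrow> f a \<in> V) \<Longrightarrow> sum f A \<in> V"
  by (simp add: csubspace_iff cvec.subspace_sum)

lemma csubspace_sum_list: "csubspace V \<Longrightarrow> set vs \<subseteq> V \<Longrightarrow> sum_list vs \<in> V"
  by (induction vs) (auto intro: csubspace_zero csubspace_add)

lemma csubspace_vecs: "csubspace (vecs I)"
  by (auto simp: csubspace_def vecs_def csmult_def)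

lemma basis_vec_in_vecs: "i \<in> I \<Longrightarrow> basis_vec i \<in> vecs I"
  by (auto simp: vecs_def basis_vec_def)

lemma vecs_expansion:
  assumes "finite I" "v \<in> vecs I"
  shows "v = (\<Sum>i\<in>I. csmult (v i) (basis_vec i))"
proof
  fix x
  show "v x = (\<Sum>i\<in>I. csmult (v i) (basis_vec i)) x"
    using assms
    by (simp add: sum_fun_apply csmult_def basis_vec_def vecs_def if_distrib[of "(*) _"] sum.delta cong: if_cong)
qed

section \<open>Maps that are linear on a subspace\<close>

lemma clinear_on_add: "clinear_on V f \<Longrightarrow> u \<in> V \<Longrightarrow> v \<in> V \<Longrightarrow> f (u + v) = f u + f v"
  and clinear_on_csmult: "clinear_on V f \<Longrightarrow> v \<in> V \<Longrightarrow> f (csmult c v) = csmult c (f v)"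
  by (auto simp: clinear_on_def)

lemma clinear_on_zero: "clinear_on V f \<Longrightarrow> csubspace V \<Longrightarrow> f 0 = 0"
  by (metis csubspace_zero clinear_on_csmult cvec.scale_zero_left)

lemma clinear_on_diff:
  assumes "clinear_on V f" "csubspace V" "u \<in> V" "v \<in> V"
  shows "f (u - v) = f u - f v"
  using clinear_on_add[OF assms(1) csubspace_diff[OF assms(2-4)] assms(4)] by simp

lemma clinear_on_sum:
  assumes "clinear_on V f" "csubspace V" "\<And>a. a \<in> A \<Longrightarrow> v a \<in> V"
  shows "f (\<Sum>a\<in>A. v a) = (\<Sum>a\<in>A. f (v a))"
  using assms(3)
proof (induction A rule: infinite_finite_induct)
  case (insert a A)
  have "f (v a + (\<Sum>a\<in>A. v a)) = f (v a) + f (\<Sum>a\<in>A. v a)"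
    using assms(1,2) insert by (intro clinear_on_add csubspace_sum) auto
  then show ?case
    using insert by (simp only: sum.insert[OF insert(1,2)]) auto
qed (use assms in \<open>auto simp: clinear_on_zero\<close>)

lemma clinear_on_subset: "clinear_on V f \<Longrightarrow> W \<subseteq> V \<Longrightarrow> clinear_on W f"
  by (simp add: clinear_on_def subset_iff)

lemma clinear_on_compose:
  "clinear_on V f \<Longrightarrow> f ` V \<subseteq> W \<Longrightarrow> clinear_on W h \<Longrightarrow> clinear_on V (\<lambda>v. h (f v))"
  by (auto simp: clinear_on_def image_subset_iff)

lemma clinear_on_inv_into:
  assumes "clinear_on V f" "csubspace V" "bij_betw f V W"
  shows "clinear_on W (inv_into V f)"
  unfolding clinear_on_def
proof (intro conjI ballI allI)
  have inV: "\<And>w. w \<in> W \<Longrightarrow> inv_into V f w \<in> V" and r: "\<And>w. w \<in> W \<Longrightarrow> f (inv_into V f w) = w"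
    and l: "\<And>v. v \<in> V \<Longrightarrow> inv_into V f (f v) = v"
    using assms(3) by (auto simp: bij_betw_def inv_into_into f_inv_into_f)
  fix u v assume u: "u \<in> W" and v: "v \<in> W"
  show "inv_into V f (u + v) = inv_into V f u + inv_into V f v"
    using l[OF csubspace_add[OF assms(2) inV[OF u] inV[OF v]]]
    by (simp add: clinear_on_add[OF assms(1)] inV u v r)
next
  have inV: "\<And>w. w \<in> W \<Longrightarrow> inv_into V f w \<in> V" and r: "\<And>w. w \<in> W \<Longrightarrow> f (inv_into V f w) = w"
    and l: "\<And>v. v \<in> V \<Longrightarrow> inv_into V f (f v) = v"
    using assms(3) by (auto simp: bij_betw_def inv_into_into f_inv_into_f)
  fix c v assume v: "v \<in> W"
  show "inv_into V f (csmult c v) = csmult c (inv_into V f v)"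
    using l[OF csubspace_csmult[OF assms(2) inV[OF v]]]
    by (simp add: clinear_on_csmult[OF assms(1)] inV v r)
qed

lemma csubspace_image:
  assumes "clinear_on V f" "csubspace V"
  shows "csubspace (f ` V)"
  unfolding csubspace_def
proof (intro conjI ballI allI)
  show "0 \<in> f ` V"
    using clinear_on_zero[OF assms] csubspace_zero[OF assms(2)] by (metis image_eqI)
next
  fix u v assume "u \<in> f ` V" "v \<in> f ` V"
  then show "u + v \<in> f ` V"
    using assms by (auto simp: clinear_on_add[symmetric] csubspace_add)
next
  fix c v assume "v \<in> f ` V"
  then show "csmult c v \<in> f ` V"
    using assms by (auto simp: clinear_on_csmult[symmetric] csubspace_csmult)
qed

text \<open>Supplies the decreasing measure for \<open>maschke\<close>. A basis \<open>B\<close> of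
  \<open>W\<close> extends to a basis \<open>C\<close> of \<open>V\<close>, which is finite because
  finitely many \<open>basis_vec i\<close> span \<open>vecs I\<close>. Equality \<open>B = C\<close>
  would put \<open>V\<close> inside the span of \<open>B\<close>, hence inside
  \<open>W\<close>.\<close>

lemma vecs_dim_psubset:
  assumes fin: "finite I" and V: "V \<subseteq> vecs I" and W: "csubspace W" and ss: "W \<subset> V"
  shows "cvec.dim W < cvec.dim V"
proof -
  have span: "vecs I \<subseteq> cvec.span (basis_vec ` I)"
  proof
    fix v :: "'a \<Rightarrow> complex" assume "v \<in> vecs I"
    then have "v = (\<Sum>i\<in>I. csmult (v i) (basis_vec i))"
      using fin vecs_expansion by blast
    also have "\<dots> \<in> cvec.span (basis_vec ` I)"
      by (intro cvec.span_sum cvec.span_scale cvec.span_base) auto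
    finally show "v \<in> cvec.span (basis_vec ` I)" .
  qed
  obtain B where B: "B \<subseteq> W" "cvec.independent B" "W \<subseteq> cvec.span B" "card B = cvec.dim W"
    using cvec.basis_exists by blast
  obtain C where C: "B \<subseteq> C" "C \<subseteq> V" "cvec.independent C" "V \<subseteq> cvec.span C"
    using cvec.maximal_independent_subset_extend[of B V] B ss by blast
  have "finite C"
    using cvec.independent_span_bound[of "basis_vec ` I" C] C(2,3) V span fin by blast
  moreover have "B \<noteq> C"
    using B C ss W by (metis csubspace_iff cvec.span_minimal order.trans psubsetE)
  ultimately have "card B < card C"
    using C(1) psubset_card_mono by blast
  then show ?thesis
    using B(4) cvec.basis_card_eq_dim[OF C(2,4,3)] by simp
qed

section \<open>Complete reducibility\<close>

lemma is_repD:
  assumes "is_rep G V T"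
  shows "csubspace V"
    and "g \<in> carrier G \<Longrightarrow> clinear_on V (T g)"
    and "g \<in> carrier G \<Longrightarrow> v \<in> V \<Longrightarrow> T g v \<in> V"
    and "v \<in> V \<Longrightarrow> T \<one>\<^bsub>G\<^esub> v = v"
    and "g \<in> carrier G \<Longrightarrow> h \<in> carrier G \<Longrightarrow> v \<in> V \<Longrightarrow> T (g \<otimes>\<^bsub>G\<^esub> h) v = T g (T h v)"
  using assms by (auto simp: is_rep_def)

lemma is_rep_subspace: "is_rep G V T \<Longrightarrow> invariant_subspace G V T W \<Longrightarrow> is_rep G W T"
  unfolding is_rep_def invariant_subspace_def
  by (auto intro: clinear_on_subset)

text \<open>Averages the conjugates \<open>T g \<circ> \<pi> \<circ> T g\<^sup>-\<^sup>1\<close> of an arbitrary linear projection \<open>\<pi>\<close> onto \<open>W\<close>.\<close>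
lemma invariant_projection:
  assumes grp: "group G" and finG: "finite (carrier G)"
    and rep: "is_rep G V T" and W: "invariant_subspace G V T W"
  obtains p where "clinear_on V p" "\<And>v. v \<in> V \<Longrightarrow> p v \<in> W" "\<And>w. w \<in> W \<Longrightarrow> p w = w"
    "\<And>g v. g \<in> carrier G \<Longrightarrow> v \<in> V \<Longrightarrow> p (T g v) = T g (p v)"
proof -
  interpret group G by fact
  note R = is_repD[OF rep]
  have sW: "csubspace W" and WV: "W \<subseteq> V" and TW: "\<And>g w. g \<in> carrier G \<Longrightarrow> w \<in> W \<Longrightarrow> T g w \<in> W"
    using W by (auto simp: invariant_subspace_def)
  have sW': "cvec.subspace W"
    using sW csubspace_iff by blast
  \<comment> \<open>A linear left inverse of the identity on \<open>W\<close>, defined everywhere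
    with values in \<open>W\<close>, is a projection onto \<open>W\<close>.\<close>
  obtain \<pi> where \<pi>: "\<pi> ` UNIV \<subseteq> W" "Vector_Spaces.linear csmult csmult \<pi>" "\<And>w. w \<in> W \<Longrightarrow> \<pi> w = w"
    using cvec_pair.linear_exists_left_inverse_on[OF cvec.linear_id sW'] by auto
  interpret \<pi>: Vector_Spaces.linear csmult csmult \<pi> by fact
  have lin: "clinear_on UNIV \<pi>"
    unfolding clinear_on_def using \<pi>.add \<pi>.scale by blast
  define s where "s v = (\<Sum>g\<in>carrier G. T g (\<pi> (T (inv\<^bsub>G\<^esub> g) v)))" for v
  define N where "N = (of_nat (card (carrier G)) :: complex)"
  have N: "N \<noteq> 0"
    using finG by (auto simp: N_def)
  define p where "p v = csmult (1 / N) (s v)" for v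
  have \<pi>W: "\<pi> v \<in> W" for v
    using \<pi>(1) by blast
  have sinW: "s v \<in> W" for v
    unfolding s_def by (intro csubspace_sum[OF sW] TW \<pi>W)
  show thesis
  proof
    have clin: "clinear_on V (\<lambda>v. T g (\<pi> (T (inv\<^bsub>G\<^esub> g) v)))" if "g \<in> carrier G" for g
    proof -
      have "clinear_on V (\<lambda>v. \<pi> (T (inv\<^bsub>G\<^esub> g) v))"
        using clinear_on_compose[OF R(2) _ lin] that by simp
      then show ?thesis
        using clinear_on_compose[OF _ _ R(2)[OF that]] \<pi>W WV by blast
    qed
    show "clinear_on V p"
      unfolding clinear_on_def
    proof (intro conjI ballI allI)
      fix u v assume "u \<in> V" "v \<in> V"
      then have "s (u + v) = s u + s v"
        unfolding s_def sum.distrib[symmetric] by (intro sum.cong refl clinear_on_add[OF clin])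
      then show "p (u + v) = p u + p v"
        by (simp add: p_def cvec.scale_right_distrib)
    next
      fix c v assume "v \<in> V"
      then have "s (csmult c v) = csmult c (s v)"
        unfolding s_def cvec.scale_sum_right by (intro sum.cong refl clinear_on_csmult[OF clin])
      then show "p (csmult c v) = csmult c (p v)"
        by (simp add: p_def mult.commute)
    qed
    show "p v \<in> W" for v
      unfolding p_def by (intro csubspace_csmult sW sinW)
    show "p w = w" if w: "w \<in> W" for w
    proof -
      have "s w = (\<Sum>g\<in>carrier G. w)"
        unfolding s_def
      proof (intro sum.cong refl)
        fix g assume g: "g \<in> carrier G"
        \<comment> \<open>Invariance keeps \<open>T (inv g) w\<close> in \<open>W\<close>, where
          \<open>\<pi>\<close> acts as the identity; so every summand of \<open>s w\<close> is
          \<open>w\<close>, and dividing by \<open>N\<close> returns \<open>w\<close>.\<close>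
        have "\<pi> (T (inv\<^bsub>G\<^esub> g) w) = T (inv\<^bsub>G\<^esub> g) w"
          using g w by (intro \<pi>(3) TW) auto
        then show "T g (\<pi> (T (inv\<^bsub>G\<^esub> g) w)) = w"
          using g w WV R(4) by (auto simp: R(5)[symmetric])
      qed
      then show ?thesis
        using N by (auto simp: p_def fun_eq_iff csmult_def sum_fun_apply N_def)
    qed
    show "p (T h v) = T h (p v)" if h: "h \<in> carrier G" and v: "v \<in> V" for h v
    proof -
      \<comment> \<open>Left translation by \<open>h\<close> permutes the group. After it, the inner
        inverse cancels \<open>h\<close> and the outer action releases a factor
        \<open>T h\<close>.\<close>
      have "s (T h v) = (\<Sum>g\<in>carrier G. T (h \<otimes>\<^bsub>G\<^esub> g) (\<pi> (T (inv\<^bsub>G\<^esub> (h \<otimes>\<^bsub>G\<^esub> g)) (T h v))))"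
        unfolding s_def
        using h by (intro sum.reindex_bij_betw[symmetric] bij_betwI[where g="\<lambda>g. inv\<^bsub>G\<^esub> h \<otimes>\<^bsub>G\<^esub> g"])
          (auto simp: m_assoc[symmetric])
      also have "\<dots> = (\<Sum>g\<in>carrier G. T h (T g (\<pi> (T (inv\<^bsub>G\<^esub> g) v))))"
      proof (intro sum.cong refl)
        fix g assume g: "g \<in> carrier G"
        have "T (inv\<^bsub>G\<^esub> (h \<otimes>\<^bsub>G\<^esub> g)) (T h v) = T (inv\<^bsub>G\<^esub> g) v"
          using g h v by (simp add: R(5)[symmetric] inv_mult_group m_assoc)
        then show "T (h \<otimes>\<^bsub>G\<^esub> g) (\<pi> (T (inv\<^bsub>G\<^esub> (h \<otimes>\<^bsub>G\<^esub> g)) (T h v))) = T h (T g (\<pi> (T (inv\<^bsub>G\<^esub> g) v)))"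
          using g h \<pi>W WV by (auto intro!: R(5))
      qed
      also have "\<dots> = T h (s v)"
        unfolding s_def using WV \<pi>W
        by (intro clinear_on_sum[symmetric, OF R(2)[OF h] R(1)] R(3)) auto
      finally show ?thesis
        using sinW WV by (auto simp: p_def clinear_on_csmult[OF R(2)[OF h]] subset_iff)
    qed
  qed
qed

text \<open>A projection splits \<open>V\<close> into its image \<open>W\<close> and its kernel
  \<open>W'\<close> through \<open>v = p v + (v - p v)\<close>, so decompositions of the two parts
  can be concatenated.\<close>

lemma irred_decomp_append:
  assumes p: "clinear_on V p" and V: "csubspace V"
    and sW: "csubspace W" and sW': "csubspace W'"
    and WV: "W \<subseteq> V" and W': "W' = {v \<in> V. p v = 0}"
    and pW: "\<And>v. v \<in> V \<Longrightarrow> p v \<in> W" "\<And>w. w \<in> W \<Longrightarrow> p w = w"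
    and As: "irred_decomp G W T As" and Bs: "irred_decomp G W' T Bs"
  shows "irred_decomp G V T (As @ Bs)"
  unfolding irred_decomp_def
proof (intro conjI ballI)
  fix U assume "U \<in> set (As @ Bs)"
  then consider "invariant_subspace G W T U" "irreducible_rep G U T"
    | "invariant_subspace G W' T U" "irreducible_rep G U T"
    using As Bs unfolding irred_decomp_def by auto
  then show "invariant_subspace G V T U" "irreducible_rep G U T"
    using WV W' by (cases; force simp: invariant_subspace_def)+
next
  have subA: "U \<subseteq> W" if "U \<in> set As" for U
    using As that unfolding irred_decomp_def invariant_subspace_def by auto
  have subB: "U \<subseteq> W'" if "U \<in> set Bs" for U
    using Bs that unfolding irred_decomp_def invariant_subspace_def by auto
  fix v assume v: "v \<in> V"
  let ?P = "\<lambda>Us v ws. length ws = length Us \<and> (\<forall>i<length Us. ws ! i \<in> Us ! i) \<and> v = sum_list ws"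
  have ex1: "\<exists>!ws. ?P As (p v) ws"
    using As pW(1)[OF v] by (auto simp: irred_decomp_def)
  have d: "v - p v \<in> W'"
    using v pW WV unfolding W' by (auto simp: clinear_on_diff[OF p V] csubspace_diff[OF V] subset_iff)
  then have ex2: "\<exists>!ws. ?P Bs (v - p v) ws"
    using Bs by (auto simp: irred_decomp_def)
  obtain as bs where as: "?P As (p v) as" and bs: "?P Bs (v - p v) bs"
    using ex1 ex2 by blast
  show "\<exists>!ws. ?P (As @ Bs) v ws"
  proof
    have "v = sum_list as + sum_list bs"
      using as bs by (metis add.commute diff_add_cancel)
    then show "?P (As @ Bs) v (as @ bs)"
      using as bs by (auto simp: nth_append)
    fix ws assume ws: "?P (As @ Bs) v ws"
    define xs ys where "xs = take (length As) ws" and "ys = drop (length As) ws"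
    have wsxy: "ws = xs @ ys" and lx: "length xs = length As" and ly: "length ys = length Bs"
      using ws by (auto simp: xs_def ys_def)
    have xin: "\<forall>i<length As. xs ! i \<in> As ! i"
    proof (intro allI impI)
      fix i assume "i < length As"
      then have "ws ! i \<in> (As @ Bs) ! i"
        using ws by simp
      then show "xs ! i \<in> As ! i"
        using \<open>i < length As\<close> by (simp add: xs_def nth_append)
    qed
    have yin: "\<forall>i<length Bs. ys ! i \<in> Bs ! i"
    proof (intro allI impI)
      fix i assume "i < length Bs"
      then have "length As + i < length (As @ Bs)"
        by simp
      then have "ws ! (length As + i) \<in> (As @ Bs) ! (length As + i)"
        using ws by blast
      moreover have "length As \<le> length ws"
        using ws by simp
      ultimately show "ys ! i \<in> Bs ! i"
        by (simp add: ys_def)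
    qed
    have "set xs \<subseteq> W"
      using xin subA lx by (metis in_set_conv_nth nth_mem subsetD subsetI)
    then have xW: "sum_list xs \<in> W"
      by (rule csubspace_sum_list[OF sW])
    have "set ys \<subseteq> W'"
      using yin subB ly by (metis in_set_conv_nth nth_mem subsetD subsetI)
    then have yW: "sum_list ys \<in> W'"
      by (rule csubspace_sum_list[OF sW'])
    have vxy: "v = sum_list xs + sum_list ys"
      using ws wsxy by simp
    \<comment> \<open>\<open>p\<close> fixes the block in \<open>W\<close> and kills the block in
      \<open>W'\<close>. Any decomposition of \<open>v\<close> thus cuts into decompositions of
      \<open>p v\<close> and \<open>v - p v\<close>, each of which is unique.\<close>
    then have "p v = sum_list xs"
      using clinear_on_add[OF p, of "sum_list xs" "sum_list ys"] xW yW WV pW W' by auto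
    then have "?P As (p v) xs" "?P Bs (v - p v) ys"
      using lx ly xin yin vxy by auto
    then show "ws = as @ bs"
      using ex1 ex2 as bs wsxy by blast
  qed
qed

text \<open>Induction on dimension: the kernel of an equivariant projection onto a proper nonzero
  invariant subspace is an invariant complement, and both pieces are strictly smaller. Allowing any
  \<open>V\<close> inside \<open>vecs I\<close> lets the induction hypothesis apply to these
  pieces.\<close>

lemma maschke:
  assumes grp: "group G" and finG: "finite (carrier G)" and finI: "finite I"
    and rep: "is_rep G V T" and V: "V \<subseteq> vecs I"
  shows "\<exists>Ws. irred_decomp G V T Ws"
  using rep V
proof (induction "cvec.dim V" arbitrary: V rule: less_induct)
  case less
  note rep = less.prems(1) and V = less.prems(2)
  note R = is_repD[OF rep]
  consider "V = {0}" | "irreducible_rep G V T"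
    | W where "V \<noteq> {0}" "invariant_subspace G V T W" "W \<noteq> {0}" "W \<noteq> V"
    using rep by (auto simp: irreducible_rep_def)
  then show ?case
  proof cases
    case 1
    \<comment> \<open>The zero space is excluded from being irreducible; it is the empty direct
      sum.\<close>
    then have "irred_decomp G V T []"
      by (auto simp: irred_decomp_def)
    then show ?thesis ..
  next
    case 2
    have "invariant_subspace G V T V"
      using R by (auto simp: invariant_subspace_def)
    moreover have "\<exists>!ws. length ws = length [V] \<and> (\<forall>i<length [V]. ws ! i \<in> [V] ! i) \<and> v = sum_list ws"
      if "v \<in> V" for v
      using that by (intro ex1I[of _ "[v]"]) (auto simp: length_Suc_conv)
    ultimately have "irred_decomp G V T [V]"
      using 2 unfolding irred_decomp_def by auto
    then show ?thesis ..
  next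
    case 3
    obtain p where p: "clinear_on V p" "\<And>v. v \<in> V \<Longrightarrow> p v \<in> W" "\<And>w. w \<in> W \<Longrightarrow> p w = w"
      "\<And>g v. g \<in> carrier G \<Longrightarrow> v \<in> V \<Longrightarrow> p (T g v) = T g (p v)"
      using invariant_projection[OF grp finG rep 3(2)] by blast
    define W' where "W' = {v \<in> V. p v = 0}"
    have sW: "csubspace W" and WV: "W \<subseteq> V"
      using 3(2) by (auto simp: invariant_subspace_def)
    have sW': "csubspace W'"
      unfolding csubspace_def W'_def
      using R(1) p(1) by (auto simp: csubspace_zero csubspace_add csubspace_csmult clinear_on_zero
          clinear_on_add clinear_on_csmult)
    have inv': "invariant_subspace G V T W'"
      unfolding invariant_subspace_def using sW' R p(4)
      by (auto simp: W'_def clinear_on_zero[OF R(2) R(1)])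
    obtain w where "w \<in> W" "w \<noteq> 0"
      using 3(3) csubspace_zero[OF sW] by blast
    \<comment> \<open>A nonzero vector of \<open>W\<close> is fixed by \<open>p\<close>, so it
      witnesses that the kernel is a proper subspace of \<open>V\<close>.\<close>
    then have "w \<notin> W'"
      using p(3) by (auto simp: W'_def)
    then have lt': "cvec.dim W' < cvec.dim V"
      using \<open>w \<in> W\<close> WV by (intro vecs_dim_psubset[OF finI V sW']) (auto simp: W'_def)
    have lt: "cvec.dim W < cvec.dim V"
      using 3(4) WV by (intro vecs_dim_psubset[OF finI V sW]) auto
    obtain As where As: "irred_decomp G W T As"
      using less.hyps[OF lt is_rep_subspace[OF rep 3(2)]] WV V by auto
    obtain Bs where Bs: "irred_decomp G W' T Bs"
      using less.hyps[OF lt' is_rep_subspace[OF rep inv']] V by (auto simp: W'_def)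
    show ?thesis
      using irred_decomp_append[OF p(1) R(1) sW sW' WV W'_def p(2,3) As Bs] by blast
  qed
qed

section \<open>Isomorphisms of representations\<close>

lemma rep_iso_sym:
  assumes rep: "is_rep G V T" and iso: "rep_iso G V T V' T'"
  shows "rep_iso G V' T' V T"
proof -
  note R = is_repD[OF rep]
  obtain f where f: "bij_betw f V V'" "clinear_on V f"
    and eq: "\<And>g v. g \<in> carrier G \<Longrightarrow> v \<in> V \<Longrightarrow> f (T g v) = T' g (f v)"
    using iso by (auto simp: rep_iso_def)
  have "inv_into V f (T' g w) = T g (inv_into V f w)" if g: "g \<in> carrier G" and w: "w \<in> V'" for g w
  proof -
    obtain v where v: "v \<in> V" "w = f v"
      using f(1) w by (auto simp: bij_betw_def)
    then show ?thesis
      using f(1) g R(3) by (simp add: eq[symmetric] bij_betw_def)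
  qed
  then show ?thesis
    unfolding rep_iso_def
    using bij_betw_inv_into[OF f(1)] clinear_on_inv_into[OF f(2) R(1) f(1)] by blast
qed

lemma rep_iso_trans:
  assumes "rep_iso G V T V' T'" "rep_iso G V' T' V'' T''"
  shows "rep_iso G V T V'' T''"
proof -
  obtain f where f: "bij_betw f V V'" "clinear_on V f" "\<forall>g\<in>carrier G. \<forall>v\<in>V. f (T g v) = T' g (f v)"
    using assms(1) by (auto simp: rep_iso_def)
  obtain h where h: "bij_betw h V' V''" "clinear_on V' h" "\<forall>g\<in>carrier G. \<forall>v\<in>V'. h (T' g v) = T'' g (h v)"
    using assms(2) by (auto simp: rep_iso_def)
  have fV: "f ` V = V'"
    using f(1) by (simp add: bij_betw_def)
  show ?thesis
    unfolding rep_iso_def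
  proof (intro exI conjI)
    show "bij_betw (\<lambda>v. h (f v)) V V''"
      using bij_betw_trans[OF f(1) h(1)] by (simp add: comp_def)
    show "clinear_on V (\<lambda>v. h (f v))"
      using clinear_on_compose[OF f(2) _ h(2)] fV by simp
    show "\<forall>g\<in>carrier G. \<forall>v\<in>V. h (f (T g v)) = T'' g (h (f v))"
      using f(3) h(3) fV by auto
  qed
qed

text \<open>Transport of structure along \<open>f\<close>: the laws of a representation carry over
  by the intertwining relation, and an invariant subspace of \<open>V'\<close> pulls back to one of
  \<open>V\<close>, which must be zero or everything.\<close>

lemma irreducible_rep_transfer:
  assumes irr: "irreducible_rep G V T" and f: "bij_betw f V V'" "clinear_on V f"
    and eq: "\<And>g v. g \<in> carrier G \<Longrightarrow> v \<in> V \<Longrightarrow> T' g (f v) = f (T g v)"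
    and one: "\<one>\<^bsub>G\<^esub> \<in> carrier G"
    and mult: "\<And>g h. g \<in> carrier G \<Longrightarrow> h \<in> carrier G \<Longrightarrow> g \<otimes>\<^bsub>G\<^esub> h \<in> carrier G"
  shows "irreducible_rep G V' T'"
proof -
  have rep: "is_rep G V T" and V0: "V \<noteq> {0}"
    and min: "\<And>W. invariant_subspace G V T W \<Longrightarrow> W = {0} \<or> W = V"
    using irr by (auto simp: irreducible_rep_def)
  note R = is_repD[OF rep]
  have V': "V' = f ` V" and inj: "inj_on f V"
    using f(1) by (auto simp: bij_betw_def)
  have f0: "f 0 = 0"
    by (rule clinear_on_zero[OF f(2) R(1)])
  have lin: "clinear_on V' (T' g)" if g: "g \<in> carrier G" for g
    unfolding clinear_on_def V'
  proof (intro conjI ballI allI; elim imageE)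
    fix u' v' u v assume "u' = f u" "v' = f v" "u \<in> V" "v \<in> V"
    then show "T' g (u' + v') = T' g u' + T' g v'"
      using g R by (simp only: clinear_on_add[OF f(2), symmetric] eq csubspace_add[OF R(1)] R(3)
          clinear_on_add[OF R(2)[OF g]])
  next
    fix c v' v assume "v' = f v" "v \<in> V"
    then show "T' g (csmult c v') = csmult c (T' g v')"
      using g R by (simp only: clinear_on_csmult[OF f(2), symmetric] eq csubspace_csmult[OF R(1)] R(3)
          clinear_on_csmult[OF R(2)[OF g]])
  qed
  have "is_rep G V' T'"
    unfolding is_rep_def
    using lin csubspace_image[OF f(2) R(1)] one mult R(3,4,5) eq by (auto simp: V')
  moreover have "V' \<noteq> {0}"
  proof -
    obtain v where "v \<in> V" "v \<noteq> 0"
      using V0 csubspace_zero[OF R(1)] by blast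
    then have "f v \<noteq> 0"
      using inj f0 csubspace_zero[OF R(1)] by (metis inj_onD)
    then show ?thesis
      using \<open>v \<in> V\<close> V' by blast
  qed
  moreover have "W = {0} \<or> W = V'" if W: "invariant_subspace G V' T' W" for W
  proof -
    have sW: "csubspace W" and WV: "W \<subseteq> V'" and TW: "\<And>g w. g \<in> carrier G \<Longrightarrow> w \<in> W \<Longrightarrow> T' g w \<in> W"
      using W by (auto simp: invariant_subspace_def)
    define U where "U = {v \<in> V. f v \<in> W}"
    have "csubspace U"
      unfolding csubspace_def U_def using sW R(1)
      by (simp add: f0 csubspace_zero csubspace_add csubspace_csmult clinear_on_add[OF f(2)] clinear_on_csmult[OF f(2)])
    moreover have "T g ` U \<subseteq> U" if "g \<in> carrier G" for g
      using that TW eq R(3) by (force simp: U_def)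
    ultimately have "invariant_subspace G V T U"
      by (auto simp: invariant_subspace_def U_def)
    then have "U = {0} \<or> U = V"
      by (rule min)
    moreover have "W = f ` U"
      using WV by (auto simp: U_def V')
    ultimately show ?thesis
      using f0 V' by auto
  qed
  ultimately show ?thesis
    by (simp add: irreducible_rep_def)
qed

text \<open>Bridges two index types: the list of irreducibles is complete for representations on
  functions on \<open>nat\<close>, whereas the summands of \<complex>X consist of functions on
  \<open>X\<close>.\<close>

lemma irreducible_rep_on_nat:
  assumes grp: "group G" and fin: "finite X" and irr: "irreducible_rep G W T" and W: "W \<subseteq> vecs X"
  obtains V' :: "(nat \<Rightarrow> complex) set" and T' where "irreducible_rep G V' T'" "rep_iso G W T V' T'"
proof -
  interpret group G by fact
  obtain b where b: "bij_betw b {0..<card X} X"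
    using ex_bij_betw_nat_finite[OF fin] by blast
  \<comment> \<open>Coordinates along the enumeration \<open>b\<close>, padded with zeros. They
    determine elements of \<open>W\<close>, because these vanish outside \<open>X\<close>.\<close>
  define f where "f v = (\<lambda>i. if i < card X then v (b i) else 0)" for v :: "_ \<Rightarrow> complex"
  have lin: "clinear_on W f"
    by (auto simp: clinear_on_def f_def csmult_def fun_eq_iff)
  have "inj_on f W"
  proof
    fix u v assume uv: "u \<in> W" "v \<in> W" and eq: "f u = f v"
    show "u = v"
    proof
      fix x
      show "u x = v x"
      proof (cases "x \<in> X")
        case True
        then obtain i where "i < card X" "x = b i"
          using b by (metis atLeastLessThan_iff bij_betw_imp_surj_on imageE)
        then show ?thesis
          using fun_cong[OF eq, of i] by (simp add: f_def)
      next
        case False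
        moreover have "u \<in> vecs X" "v \<in> vecs X"
          using uv W by auto
        ultimately show ?thesis
          by (simp add: vecs_def)
      qed
    qed
  qed
  then have bij: "bij_betw f W (f ` W)"
    by (simp add: bij_betw_def)
  define T' where "T' g u = f (T g (inv_into W f u))" for g u
  have eq: "T' g (f v) = f (T g v)" if "v \<in> W" for g v
    using that \<open>inj_on f W\<close> by (simp add: T'_def)
  show thesis
  proof
    show "irreducible_rep G (f ` W) T'"
      using irreducible_rep_transfer[OF irr bij lin] eq by simp
    show "rep_iso G W T (f ` W) T'"
      using bij lin eq unfolding rep_iso_def by auto
  qed
qed

section \<open>Characters\<close>

text \<open>The trace in the standard basis of \<open>vecs I\<close>; applied to \<open>T g\<close>
  it is the character of the representation at \<open>g\<close>.\<close>

definition ctrace :: "'i set \<Rightarrow> (('i \<Rightarrow> complex) \<Rightarrow> ('i \<Rightarrow> complex)) \<Rightarrow> complex" where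
  "ctrace I f = (\<Sum>i\<in>I. f (basis_vec i) i)"

lemma clinear_on_expansion:
  assumes "finite I" "clinear_on (vecs I) f" "v \<in> vecs I"
  shows "f v j = (\<Sum>i\<in>I. v i * f (basis_vec i) j)"
proof -
  have "f v = f (\<Sum>i\<in>I. csmult (v i) (basis_vec i))"
    using vecs_expansion[OF assms(1,3)] by simp
  also have "\<dots> = (\<Sum>i\<in>I. f (csmult (v i) (basis_vec i)))"
    by (intro clinear_on_sum[OF assms(2)] csubspace_vecs csubspace_csmult basis_vec_in_vecs)
  also have "\<dots> = (\<Sum>i\<in>I. csmult (v i) (f (basis_vec i)))"
    by (intro sum.cong refl clinear_on_csmult[OF assms(2)] basis_vec_in_vecs)
  finally show ?thesis
    by (simp add: sum_fun_apply csmult_def)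
qed

text \<open>Both sides expand to the same double sum of products of matrix entries. The index sets
  may differ, so a trace on \<complex>X can be exchanged for a trace on an irreducible
  model.\<close>

lemma ctrace_commute:
  assumes fin: "finite I" "finite J"
    and A: "clinear_on (vecs I) A" "A ` vecs I \<subseteq> vecs J"
    and B: "clinear_on (vecs J) B" "B ` vecs J \<subseteq> vecs I"
  shows "ctrace I (\<lambda>v. B (A v)) = ctrace J (\<lambda>v. A (B v))"
proof -
  have Ab: "A (basis_vec i) \<in> vecs J" if "i \<in> I" for i
    using A(2) basis_vec_in_vecs[OF that] by (simp add: image_subset_iff)
  have Bb: "B (basis_vec j) \<in> vecs I" if "j \<in> J" for j
    using B(2) basis_vec_in_vecs[OF that] by (simp add: image_subset_iff)
  have "ctrace I (\<lambda>v. B (A v)) = (\<Sum>i\<in>I. \<Sum>j\<in>J. A (basis_vec i) j * B (basis_vec j) i)"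
    unfolding ctrace_def by (intro sum.cong refl clinear_on_expansion[OF fin(2) B(1)] Ab)
  also have "\<dots> = (\<Sum>j\<in>J. \<Sum>i\<in>I. B (basis_vec j) i * A (basis_vec i) j)"
    by (subst sum.swap) (simp add: mult.commute)
  also have "\<dots> = ctrace J (\<lambda>v. A (B v))"
    unfolding ctrace_def by (intro sum.cong refl clinear_on_expansion[OF fin(1) A(1), symmetric] Bb)
  finally show ?thesis .
qed

text \<open>With \<open>f : W \<rightarrow> \<complex>\<^sup>J\<close> the isomorphism, \<open>T g \<circ> p = (f\<^sup>-\<^sup>1 \<circ> S g) \<circ> (f \<circ> p)\<close>, and swapping the two
  factors cancels \<open>p\<close> since \<open>p\<close> is the identity on \<open>W\<close>.\<close>
lemma ctrace_component:
  assumes fin: "finite I" "finite J"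
    and inv: "invariant_subspace G (vecs I) T W" and rep: "is_rep G (vecs I) T"
    and p: "clinear_on (vecs I) p" "\<And>v. v \<in> vecs I \<Longrightarrow> p v \<in> W" "\<And>w. w \<in> W \<Longrightarrow> p w = w"
    and iso: "rep_iso G W T (vecs J) S" and g: "g \<in> carrier G"
  shows "ctrace I (\<lambda>v. T g (p v)) = ctrace J (S g)"
proof -
  have sW: "csubspace W" and WI: "W \<subseteq> vecs I" and TW: "\<And>w. w \<in> W \<Longrightarrow> T g w \<in> W"
    using inv g by (auto simp: invariant_subspace_def)
  obtain f where f: "bij_betw f W (vecs J)" "clinear_on W f"
    and eq: "\<And>v. v \<in> W \<Longrightarrow> f (T g v) = S g (f v)"
    using iso g by (auto simp: rep_iso_def)
  define h where "h = inv_into W f"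
  have h: "clinear_on (vecs J) h" "\<And>u. u \<in> vecs J \<Longrightarrow> h u \<in> W" "\<And>u. u \<in> vecs J \<Longrightarrow> f (h u) = u"
    "\<And>w. w \<in> W \<Longrightarrow> h (f w) = w" "\<And>w. w \<in> W \<Longrightarrow> f w \<in> vecs J"
    using clinear_on_inv_into[OF f(2) sW f(1)] f(1)
    by (auto simp: h_def bij_betw_def inv_into_into f_inv_into_f)
  have T_eq: "T g (h u) = h (S g u)" if "u \<in> vecs J" for u
    using that by (metis TW eq h(2,3,4))
  have lin1: "clinear_on (vecs I) (\<lambda>v. f (p v))"
    using clinear_on_compose[OF p(1) _ f(2)] p(2) by blast
  have "clinear_on W (T g)"
    using clinear_on_subset[OF is_repD(2)[OF rep g] WI] .
  then have lin2: "clinear_on (vecs J) (\<lambda>u. T g (h u))"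
    using clinear_on_compose[OF h(1)] h(2) by blast
  have "ctrace I (\<lambda>v. T g (p v)) = ctrace I (\<lambda>v. T g (h (f (p v))))"
    unfolding ctrace_def using p(2) h(4) by (simp add: basis_vec_in_vecs)
  also have "\<dots> = ctrace J (\<lambda>u. f (p (T g (h u))))"
    by (rule ctrace_commute[OF fin lin1 _ lin2]) (use p(2) h(2,5) TW WI in auto)
  also have "\<dots> = ctrace J (S g)"
    unfolding ctrace_def
  proof (intro sum.cong refl)
    fix j assume "j \<in> J"
    then have b: "basis_vec j \<in> vecs J"
      by (rule basis_vec_in_vecs)
    show "f (p (T g (h (basis_vec j)))) j = S g (basis_vec j) j"
      using b by (simp add: p(3) TW h(2,3) eq)
  qed
  finally show ?thesis .
qed

text \<open>Uniqueness makes each component a function of \<open>v\<close>. It is linear because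
  adding or scaling decompositions again gives decompositions.\<close>

lemma irred_decomp_projections:
  assumes dec: "irred_decomp G V T Ws" and V: "csubspace V"
  obtains p where
    "\<And>i. i < length Ws \<Longrightarrow> clinear_on V (p i)"
    "\<And>i v. i < length Ws \<Longrightarrow> v \<in> V \<Longrightarrow> p i v \<in> Ws ! i"
    "\<And>i w. i < length Ws \<Longrightarrow> w \<in> Ws ! i \<Longrightarrow> p i w = w"
    "\<And>v. v \<in> V \<Longrightarrow> v = (\<Sum>i<length Ws. p i v)"
proof -
  let ?n = "length Ws"
  let ?P = "\<lambda>v ws. length ws = ?n \<and> (\<forall>i<?n. ws ! i \<in> Ws ! i) \<and> v = sum_list ws"
  have ex1: "\<And>v. v \<in> V \<Longrightarrow> \<exists>!ws. ?P v ws"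
    using dec by (auto simp: irred_decomp_def)
  have sub: "csubspace (Ws ! i)" "Ws ! i \<subseteq> V" if "i < ?n" for i
    using dec nth_mem[OF that] by (auto simp: irred_decomp_def invariant_subspace_def)
  define c where "c v = (THE ws. ?P v ws)" for v
  have c: "?P v (c v)" if "v \<in> V" for v
    unfolding c_def by (rule theI'[OF ex1[OF that]])
  have c_sum: "v = (\<Sum>i<?n. c v ! i)" if "v \<in> V" for v
    using c[OF that] by (metis sum_list_sum_nth atLeast0LessThan)
  \<comment> \<open>Each property below is proved by exhibiting a family of components with the
    right sum and identifying it with \<open>c v\<close> here.\<close>
  have uniq: "c v ! i = ws i" if v: "v = (\<Sum>i<?n. ws i)" and ws: "\<And>i. i < ?n \<Longrightarrow> ws i \<in> Ws ! i" and i: "i < ?n"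
    for v ws i
  proof -
    have "v \<in> V"
      unfolding v by (intro csubspace_sum[OF V]) (use ws sub in auto)
    moreover have "?P v (map ws [0..<?n])"
      using ws by (auto simp: v interv_sum_list_conv_sum_set_nat atLeast0LessThan)
    ultimately have "c v = map ws [0..<?n]"
      using ex1 c by blast
    then show ?thesis
      using i by simp
  qed
  show thesis
  proof
    fix i assume i: "i < ?n"
    show "clinear_on V (\<lambda>v. c v ! i)"
      unfolding clinear_on_def
    proof (intro conjI ballI allI)
      fix u v assume u: "u \<in> V" and v: "v \<in> V"
      show "c (u + v) ! i = c u ! i + c v ! i"
      proof (rule uniq[OF _ _ i])
        show "u + v = (\<Sum>i<?n. c u ! i + c v ! i)"
          unfolding sum.distrib using c_sum[OF u] c_sum[OF v] by simp
        show "\<And>i. i < ?n \<Longrightarrow> c u ! i + c v ! i \<in> Ws ! i"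
          using c u v sub by (intro csubspace_add) auto
      qed
    next
      fix a v assume v: "v \<in> V"
      show "c (csmult a v) ! i = csmult a (c v ! i)"
      proof (rule uniq[OF _ _ i])
        show "csmult a v = (\<Sum>i<?n. csmult a (c v ! i))"
          unfolding cvec.scale_sum_right[symmetric] using c_sum[OF v] by simp
        show "\<And>i. i < ?n \<Longrightarrow> csmult a (c v ! i) \<in> Ws ! i"
          using c v sub by (intro csubspace_csmult) auto
      qed
    qed
    show "c v ! i \<in> Ws ! i" if "v \<in> V" for v
      using c[OF that] i by blast
    show "c w ! i = w" if w: "w \<in> Ws ! i" for w
    proof -
      \<comment> \<open>The odd \<open>if i = i\<close> is the value at position \<open>i\<close> of
        the family that has \<open>w\<close> there and \<open>0\<close> elsewhere, so that
        \<open>uniq\<close> applies literally.\<close>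
      have "c w ! i = (if i = i then w else 0)"
      proof (rule uniq[OF _ _ i, where ws="\<lambda>l. if l = i then w else 0"])
        show "w = (\<Sum>l<?n. if l = i then w else 0)"
          using i by (subst sum.delta) auto
        show "\<And>l. l < ?n \<Longrightarrow> (if l = i then w else 0) \<in> Ws ! l"
          using w sub by (auto simp: csubspace_zero)
      qed
      then show ?thesis by simp
    qed
  next
    show "\<And>v. v \<in> V \<Longrightarrow> v = (\<Sum>i<?n. c v ! i)"
      by (rule c_sum)
  qed
qed

text \<open>The component projections sum to the identity, so \<open>T g\<close> is the sum of the
  maps \<open>T g\<close> after \<open>p i\<close>. The trace is additive, and
  \<open>ctrace_component\<close> evaluates each term on its model.\<close>

lemma irred_decomp_ctrace:
  assumes fin: "finite I" and rep: "is_rep G (vecs I) T" and dec: "irred_decomp G (vecs I) T Ws"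
    and iso: "\<And>i. i < length Ws \<Longrightarrow> rep_iso G (Ws ! i) T (vecs (J i)) (S i)"
    and J: "\<And>i. i < length Ws \<Longrightarrow> finite (J i)" and g: "g \<in> carrier G"
  shows "ctrace I (T g) = (\<Sum>i<length Ws. ctrace (J i) (S i g))"
proof -
  obtain p where p:
    "\<And>i. i < length Ws \<Longrightarrow> clinear_on (vecs I) (p i)"
    "\<And>i v. i < length Ws \<Longrightarrow> v \<in> vecs I \<Longrightarrow> p i v \<in> Ws ! i"
    "\<And>i w. i < length Ws \<Longrightarrow> w \<in> Ws ! i \<Longrightarrow> p i w = w"
    "\<And>v. v \<in> vecs I \<Longrightarrow> v = (\<Sum>i<length Ws. p i v)"
    using irred_decomp_projections[OF dec csubspace_vecs] by blast
  have inv: "invariant_subspace G (vecs I) T (Ws ! i)" if "i < length Ws" for i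
    using dec nth_mem[OF that] by (auto simp: irred_decomp_def)
  have pV: "p i v \<in> vecs I" if "i < length Ws" "v \<in> vecs I" for i v
    using p(2)[OF that] inv[OF that(1)] by (auto simp: invariant_subspace_def)
  have split: "T g v = (\<Sum>i<length Ws. T g (p i v))" if v: "v \<in> vecs I" for v
  proof -
    have "T g v = T g (\<Sum>i<length Ws. p i v)"
      using p(4)[OF v] by simp
    then show ?thesis
      using clinear_on_sum[OF is_repD(2)[OF rep g] csubspace_vecs, of "{..<length Ws}" "\<lambda>i. p i v"] pV v by simp
  qed
  have "ctrace I (T g) = (\<Sum>x\<in>I. \<Sum>i<length Ws. T g (p i (basis_vec x)) x)"
    unfolding ctrace_def by (intro sum.cong refl) (simp only: split basis_vec_in_vecs sum_fun_apply)
  also have "\<dots> = (\<Sum>i<length Ws. ctrace I (\<lambda>v. T g (p i v)))"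
    unfolding ctrace_def by (rule sum.swap)
  also have "\<dots> = (\<Sum>i<length Ws. ctrace (J i) (S i g))"
    by (intro sum.cong refl ctrace_component[OF fin J inv rep p(1,2,3) iso g]) auto
  finally show ?thesis .
qed

section \<open>The permutation representation\<close>

lemma perm_act_rep:
  assumes act: "group_action G X \<phi>" and fin: "finite X"
  shows "is_rep G (vecs X) (perm_act X \<phi>)"
proof -
  interpret group_action G X \<phi> by fact
  have im: "\<phi> g x \<in> X" if "g \<in> carrier G" "x \<in> X" for g x
    using element_image that by blast
  have one: "perm_act X \<phi> \<one>\<^bsub>G\<^esub> v = v" if v: "v \<in> vecs X" for v
  proof
    fix y
    have "perm_act X \<phi> \<one>\<^bsub>G\<^esub> v y = (\<Sum>x\<in>X. if x = y then v x else 0)"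
      unfolding perm_act_def by (intro sum.cong refl) (simp add: id_eq_one[symmetric])
    also have "\<dots> = v y"
      using fin v by (auto simp: vecs_def)
    finally show "perm_act X \<phi> \<one>\<^bsub>G\<^esub> v y = v y" .
  qed
  have mult: "perm_act X \<phi> (g \<otimes>\<^bsub>G\<^esub> h) v = perm_act X \<phi> g (perm_act X \<phi> h v)"
    if g: "g \<in> carrier G" and h: "h \<in> carrier G" for g h v
  proof
    fix y
    have "perm_act X \<phi> g (perm_act X \<phi> h v) y
        = (\<Sum>x\<in>X. \<Sum>z\<in>X. if \<phi> g x = y \<and> \<phi> h z = x then v z else 0)"
      unfolding perm_act_def by (intro sum.cong refl) auto
    also have "\<dots> = (\<Sum>z\<in>X. \<Sum>x\<in>X. if x = \<phi> h z then (if \<phi> g x = y then v z else 0) else 0)"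
      by (subst sum.swap) (intro sum.cong refl, auto)
    \<comment> \<open>The index \<open>x\<close> is forced to be \<open>\<phi> h z\<close>; this
      point lies in \<open>X\<close>, so exactly one term survives.\<close>
    also have "\<dots> = (\<Sum>z\<in>X. if \<phi> g (\<phi> h z) = y then v z else 0)"
      using fin im[OF h] by (intro sum.cong refl) (simp add: sum.delta')
    also have "\<dots> = perm_act X \<phi> (g \<otimes>\<^bsub>G\<^esub> h) v y"
      unfolding perm_act_def using g h by (intro sum.cong refl) (simp add: composition_rule)
    finally show "perm_act X \<phi> (g \<otimes>\<^bsub>G\<^esub> h) v y = perm_act X \<phi> g (perm_act X \<phi> h v) y"
      by simp
  qed
  have lin: "clinear_on (vecs X) (perm_act X \<phi> g)" for g
    unfolding clinear_on_def perm_act_def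
    by (auto simp: csmult_def fun_eq_iff sum.distrib[symmetric] sum_distrib_left intro!: sum.cong)
  have "perm_act X \<phi> g v \<in> vecs X" if "g \<in> carrier G" for g v
    unfolding vecs_def perm_act_def using im[OF that] by (auto intro!: sum.neutral)
  then show ?thesis
    unfolding is_rep_def using one mult lin csubspace_vecs by blast
qed

text \<open>A permutation matrix has a diagonal entry 1 precisely at the fixed points.\<close>

lemma ctrace_perm_act:
  assumes "finite X"
  shows "ctrace X (perm_act X \<phi> g) = of_nat (card (invariants X \<phi> g))"
proof -
  have "perm_act X \<phi> g (basis_vec x) x = (if \<phi> g x = x then 1 else 0)" if "x \<in> X" for x
  proof -
    have "perm_act X \<phi> g (basis_vec x) x = (\<Sum>z\<in>X. if z = x then (if \<phi> g x = x then 1 else 0) else 0)"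
      unfolding perm_act_def basis_vec_def by (intro sum.cong refl) auto
    then show ?thesis
      using that assms by (simp add: sum.delta)
  qed
  then have "ctrace X (perm_act X \<phi> g) = (\<Sum>x\<in>X. if \<phi> g x = x then 1 else 0)"
    by (simp add: ctrace_def)
  also have "\<dots> = of_nat (card (invariants X \<phi> g))"
    using assms by (simp add: sum.If_cases invariants_def Int_def)
  finally show ?thesis .
qed

lemma ctrace_mat_rep_action:
  "ctrace {..<d} (mat_rep_action d \<rho> g) = (\<Sum>i<d. \<rho> g i i)"
  unfolding ctrace_def mat_rep_action_def mat_act_def basis_vec_def
  by (intro sum.cong refl) (simp add: if_distrib[of "(*) _"] sum.delta cong: if_cong)

text \<open>Completeness gives each irreducible summand of \<complex>X a model among the listed
  representations, and pairwise non-isomorphism makes the model unique. Grouping the summands by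
  model turns the trace formula into a sum weighted by multiplicities.\<close>

lemma perm_character_decomposition:
  fixes k :: nat and d :: "nat \<Rightarrow> nat"
  assumes grp: "group G" and finG: "finite (carrier G)"
    and irred: "\<And>j. j < k \<Longrightarrow> irreducible_rep G (vecs {..<d j}) (mat_rep_action (d j) (\<rho> j))"
    and noniso: "\<And>i j. i < k \<Longrightarrow> j < k \<Longrightarrow> i \<noteq> j \<Longrightarrow>
        \<not> rep_iso G (vecs {..<d i}) (mat_rep_action (d i) (\<rho> i)) (vecs {..<d j}) (mat_rep_action (d j) (\<rho> j))"
    and complete: "\<And>(V :: (nat \<Rightarrow> complex) set) T. irreducible_rep G V T \<Longrightarrow>
        \<exists>j<k. rep_iso G V T (vecs {..<d j}) (mat_rep_action (d j) (\<rho> j))"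
    and act: "group_action G X \<phi>" and finX: "finite X" and g: "g \<in> carrier G"
  shows "of_nat (card (invariants X \<phi> g)) =
    (\<Sum>j<k. of_nat (multiplicity G (vecs {..<d j}) (mat_rep_action (d j) (\<rho> j)) (vecs X) (perm_act X \<phi>))
       * (\<Sum>i<d j. \<rho> j g i i))"
proof -
  let ?U = "\<lambda>j. vecs {..<d j}" and ?S = "\<lambda>j. mat_rep_action (d j) (\<rho> j)" and ?T = "perm_act X \<phi>"
  \<comment> \<open>The very decomposition chosen inside \<open>multiplicity\<close>, so its
    summands are the ones counted there; \<open>maschke\<close> ensures that the choice meets its
    specification.\<close>
  define Ws where "Ws = (SOME Ws. irred_decomp G (vecs X) ?T Ws)"
  note rep = perm_act_rep[OF act finX]
  have dec: "irred_decomp G (vecs X) ?T Ws"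
    unfolding Ws_def using maschke[OF grp finG finX rep subset_refl] by (rule someI_ex)
  have "\<exists>j<k. rep_iso G W ?T (?U j) (?S j)" if "W \<in> set Ws" for W
  proof -
    have W: "irreducible_rep G W ?T" "W \<subseteq> vecs X"
      using dec that by (auto simp: irred_decomp_def invariant_subspace_def)
    obtain V' :: "(nat \<Rightarrow> complex) set" and T' where "irreducible_rep G V' T'" "rep_iso G W ?T V' T'"
      using irreducible_rep_on_nat[OF grp finX W] by blast
    then show ?thesis
      using complete rep_iso_trans by meson
  qed
  then have "\<forall>i. \<exists>j. i < length Ws \<longrightarrow> j < k \<and> rep_iso G (Ws ! i) ?T (?U j) (?S j)"
    using nth_mem by blast
  from choice[OF this] obtain J where J: "\<And>i. i < length Ws \<Longrightarrow> J i < k"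
    "\<And>i. i < length Ws \<Longrightarrow> rep_iso G (Ws ! i) ?T (?U (J i)) (?S (J i))"
    by blast
  \<comment> \<open>A summand isomorphic to two models would make the models isomorphic to each
    other.\<close>
  have J_iff: "rep_iso G (Ws ! i) ?T (?U j) (?S j) \<longleftrightarrow> J i = j" if i: "i < length Ws" and j: "j < k" for i j
  proof
    assume "rep_iso G (Ws ! i) ?T (?U j) (?S j)"
    moreover have "is_rep G (Ws ! i) ?T"
      using dec nth_mem[OF i] by (auto simp: irred_decomp_def irreducible_rep_def)
    ultimately have "rep_iso G (?U (J i)) (?S (J i)) (?U j) (?S j)"
      using J(2)[OF i] rep_iso_sym rep_iso_trans by metis
    then show "J i = j"
      using noniso J(1)[OF i] j by blast
  qed (use J(2) i in blast)
  have mult: "multiplicity G (?U j) (?S j) (vecs X) ?T = card {i. i < length Ws \<and> J i = j}" if "j < k" for j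
    unfolding multiplicity_def Ws_def[symmetric] length_filter_conv_card
    using J_iff that by (intro arg_cong[where f=card]) auto
  have "of_nat (card (invariants X \<phi> g)) = (\<Sum>i<length Ws. ctrace {..<d (J i)} (?S (J i) g))"
    unfolding ctrace_perm_act[OF finX, symmetric]
    by (rule irred_decomp_ctrace[OF finX rep dec _ _ g]) (use J in auto)
  also have "\<dots> = (\<Sum>j<k. \<Sum>i\<in>{i\<in>{..<length Ws}. J i = j}. ctrace {..<d (J i)} (?S (J i) g))"
    by (rule sum.group[symmetric]) (use J in auto)
  also have "\<dots> = (\<Sum>j<k. of_nat (multiplicity G (?U j) (?S j) (vecs X) ?T) * (\<Sum>i<d j. \<rho> j g i i))"
  proof (intro sum.cong refl)
    fix j assume j: "j \<in> {..<k}"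
    have "(\<Sum>i\<in>{i\<in>{..<length Ws}. J i = j}. ctrace {..<d (J i)} (?S (J i) g))
        = (\<Sum>i\<in>{i\<in>{..<length Ws}. J i = j}. \<Sum>i<d j. \<rho> j g i i)"
      by (intro sum.cong refl) (simp add: ctrace_mat_rep_action)
    then show "(\<Sum>i\<in>{i\<in>{..<length Ws}. J i = j}. ctrace {..<d (J i)} (?S (J i) g))
        = of_nat (multiplicity G (?U j) (?S j) (vecs X) ?T) * (\<Sum>i<d j. \<rho> j g i i)"
      using mult j by simp
  qed
  finally show ?thesis .
qed

section \<open>Plancherel identity and norm estimates\<close>

text \<open>Orthonormal rows say that \<open>\<rho> h\<close> times its adjoint is the identity;
  multiplying on the left by the matrix of the inverse of \<open>h\<close> identifies that matrix
  with the adjoint.\<close>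

lemma unitary_mat_rep_inv:
  assumes grp: "group G" and u: "unitary_mat_rep G d \<rho>" and h: "h \<in> carrier G" and ij: "i < d" "j < d"
  shows "\<rho> (inv\<^bsub>G\<^esub> h) i j = cnj (\<rho> h j i)"
proof -
  interpret group G by fact
  have orth: "(\<Sum>m<d. \<rho> h l m * cnj (\<rho> h j m)) = (if l = j then 1 else 0)" if "l < d" for l
    using u h that ij by (auto simp: unitary_mat_rep_def unitary_mat_def)
  have "\<rho> (inv\<^bsub>G\<^esub> h) i j = (\<Sum>l<d. \<rho> (inv\<^bsub>G\<^esub> h) i l * (if l = j then 1 else 0))"
    using ij by (simp add: if_distrib[of "(*) _"] sum.delta cong: if_cong)
  also have "\<dots> = (\<Sum>l<d. \<Sum>m<d. \<rho> (inv\<^bsub>G\<^esub> h) i l * \<rho> h l m * cnj (\<rho> h j m))"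
    by (intro sum.cong refl) (simp add: orth[symmetric] sum_distrib_left mult.assoc)
  also have "\<dots> = (\<Sum>m<d. (\<Sum>l<d. \<rho> (inv\<^bsub>G\<^esub> h) i l * \<rho> h l m) * cnj (\<rho> h j m))"
    by (subst sum.swap) (simp add: sum_distrib_right)
  also have "\<dots> = (\<Sum>m<d. (if i = m then 1 else 0) * cnj (\<rho> h j m))"
  proof (intro sum.cong refl)
    fix m assume m: "m \<in> {..<d}"
    have "(\<Sum>l<d. \<rho> (inv\<^bsub>G\<^esub> h) i l * \<rho> h l m) = \<rho> (inv\<^bsub>G\<^esub> h \<otimes>\<^bsub>G\<^esub> h) i m"
      using u h m ij by (simp add: unitary_mat_rep_def del: l_inv Units_l_inv)
    also have "\<dots> = (if i = m then 1 else 0)"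
      using u m ij unfolding l_inv[OF h] by (simp add: unitary_mat_rep_def)
    finally show "(\<Sum>l<d. \<rho> (inv\<^bsub>G\<^esub> h) i l * \<rho> h l m) * cnj (\<rho> h j m) = (if i = m then 1 else 0) * cnj (\<rho> h j m)"
      by simp
  qed
  also have "\<dots> = (\<Sum>m<d. if i = m then cnj (\<rho> h j m) else 0)"
    by (intro sum.cong refl) auto
  also have "\<dots> = cnj (\<rho> h j i)"
    using ij by (simp add: sum.delta')
  finally show ?thesis .
qed

text \<open>Each squared modulus is an entry times its conjugate. As \<open>Q\<close> is real,
  conjugation only meets \<open>\<rho> h\<close>, turning it into the matrix of the inverse, and the
  sum over entries becomes a trace.\<close>

lemma frob_sq_fourier:
  assumes grp: "group G" and u: "unitary_mat_rep G d \<rho>"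
  shows "of_real (frob_sq d (fourier G Q \<rho>)) =
    (\<Sum>g\<in>carrier G. \<Sum>h\<in>carrier G. of_real (Q g * Q h) * (\<Sum>l<d. \<rho> (inv\<^bsub>G\<^esub> h \<otimes>\<^bsub>G\<^esub> g) l l))"
proof -
  interpret group G by fact
  let ?C = "carrier G"
  have "of_real (frob_sq d (fourier G Q \<rho>))
      = (\<Sum>i<d. \<Sum>l<d. fourier G Q \<rho> i l * cnj (fourier G Q \<rho> i l))"
    by (simp add: frob_sq_def complex_norm_square del: of_real_power)
  also have "\<dots> = (\<Sum>i<d. \<Sum>l<d. \<Sum>g\<in>?C. \<Sum>h\<in>?C. of_real (Q g * Q h) * (cnj (\<rho> h i l) * \<rho> g i l))"
    unfolding fourier_def by (intro sum.cong refl) (simp add: sum_product mult_ac)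
  also have "\<dots> = (\<Sum>i<d. \<Sum>g\<in>?C. \<Sum>h\<in>?C. \<Sum>l<d. of_real (Q g * Q h) * (cnj (\<rho> h i l) * \<rho> g i l))"
    by (subst sum.swap, subst (2) sum.swap) (rule refl)
  also have "\<dots> = (\<Sum>g\<in>?C. \<Sum>h\<in>?C. \<Sum>i<d. \<Sum>l<d. of_real (Q g * Q h) * (cnj (\<rho> h i l) * \<rho> g i l))"
    by (subst sum.swap, subst (2) sum.swap) (rule refl)
  also have "\<dots> = (\<Sum>g\<in>?C. \<Sum>h\<in>?C. of_real (Q g * Q h) * (\<Sum>l<d. \<rho> (inv\<^bsub>G\<^esub> h \<otimes>\<^bsub>G\<^esub> g) l l))"
  proof (intro sum.cong refl)
    fix g h assume g: "g \<in> ?C" and h: "h \<in> ?C"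
    have "(\<Sum>i<d. \<Sum>l<d. cnj (\<rho> h i l) * \<rho> g i l) = (\<Sum>l<d. \<Sum>i<d. \<rho> (inv\<^bsub>G\<^esub> h) l i * \<rho> g i l)"
      by (subst sum.swap) (simp add: unitary_mat_rep_inv[OF grp u h])
    also have "\<dots> = (\<Sum>l<d. \<rho> (inv\<^bsub>G\<^esub> h \<otimes>\<^bsub>G\<^esub> g) l l)"
      using u g h by (simp add: unitary_mat_rep_def)
    finally show "(\<Sum>i<d. \<Sum>l<d. of_real (Q g * Q h) * (cnj (\<rho> h i l) * \<rho> g i l))
        = of_real (Q g * Q h) * (\<Sum>l<d. \<rho> (inv\<^bsub>G\<^esub> h \<otimes>\<^bsub>G\<^esub> g) l l)"
      by (simp only: sum_distrib_left[symmetric])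
  qed
  finally show ?thesis .
qed

text \<open>For a probability distribution \<open>Q\<close> this coefficient is the chance that a
  random group element sends \<open>x\<close> to \<open>y\<close>; in particular it is real.\<close>

lemma alg_act_basis_vec:
  assumes "finite X" "x \<in> X"
  shows "alg_act G X \<phi> Q (basis_vec x) y = of_real (\<Sum>g\<in>carrier G. if \<phi> g x = y then Q g else 0)"
proof -
  have "perm_act X \<phi> g (basis_vec x) y = (if \<phi> g x = y then 1 else 0)" for g
  proof -
    have "perm_act X \<phi> g (basis_vec x) y = (\<Sum>z\<in>X. if z = x then (if \<phi> g x = y then 1 else 0) else 0)"
      unfolding perm_act_def basis_vec_def by (intro sum.cong refl) auto
    then show ?thesis
      using assms by (simp add: sum.delta)
  qed
  then show ?thesis
    unfolding alg_act_def of_real_sum by (intro sum.cong refl) auto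
qed

text \<open>Squaring the coefficients pairs up \<open>g\<close> and \<open>h\<close> with
  \<open>\<phi> g x = \<phi> h x\<close>, that is, with \<open>x\<close> fixed by
  \<open>inv h \<otimes> g\<close>. Summing over \<open>x\<close> then counts fixed points.\<close>

lemma sum_l2_norm_alg_act:
  assumes act: "group_action G X \<phi>" and fin: "finite X"
  shows "(\<Sum>x\<in>X. (l2_norm X (alg_act G X \<phi> Q (basis_vec x)))\<^sup>2) =
    (\<Sum>g\<in>carrier G. \<Sum>h\<in>carrier G. Q g * Q h * real (card (invariants X \<phi> (inv\<^bsub>G\<^esub> h \<otimes>\<^bsub>G\<^esub> g))))"
proof -
  interpret group_action G X \<phi> by fact
  interpret group G
    using group_hom group_hom.axioms(1) by auto
  let ?C = "carrier G"
  have im: "\<phi> g x \<in> X" if "g \<in> carrier G" "x \<in> X" for g x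
    using element_image that by blast
  have "(l2_norm X (alg_act G X \<phi> Q (basis_vec x)))\<^sup>2
      = (\<Sum>g\<in>?C. \<Sum>h\<in>?C. if \<phi> g x = \<phi> h x then Q g * Q h else 0)" if x: "x \<in> X" for x
  proof -
    have "(l2_norm X (alg_act G X \<phi> Q (basis_vec x)))\<^sup>2
        = (\<Sum>y\<in>X. (\<Sum>g\<in>?C. if \<phi> g x = y then Q g else 0)\<^sup>2)"
      unfolding l2_norm_def by (simp add: sum_nonneg alg_act_basis_vec[OF fin x] del: of_real_sum)
    also have "\<dots> = (\<Sum>y\<in>X. \<Sum>g\<in>?C. \<Sum>h\<in>?C. if \<phi> g x = y then (if \<phi> h x = y then Q g * Q h else 0) else 0)"
      unfolding power2_eq_square sum_product by (intro sum.cong refl) auto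
    also have "\<dots> = (\<Sum>g\<in>?C. \<Sum>h\<in>?C. \<Sum>y\<in>X. if \<phi> g x = y then (if \<phi> h x = y then Q g * Q h else 0) else 0)"
      by (subst sum.swap, subst (2) sum.swap) (rule refl)
    also have "\<dots> = (\<Sum>g\<in>?C. \<Sum>h\<in>?C. if \<phi> g x = \<phi> h x then Q g * Q h else 0)"
      using im x fin by (intro sum.cong refl) (auto simp: sum.delta)
    finally show ?thesis .
  qed
  then have "(\<Sum>x\<in>X. (l2_norm X (alg_act G X \<phi> Q (basis_vec x)))\<^sup>2)
      = (\<Sum>x\<in>X. \<Sum>g\<in>?C. \<Sum>h\<in>?C. if \<phi> g x = \<phi> h x then Q g * Q h else 0)"
    by simp
  also have "\<dots> = (\<Sum>g\<in>?C. \<Sum>h\<in>?C. \<Sum>x\<in>X. if \<phi> g x = \<phi> h x then Q g * Q h else 0)"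
    by (subst sum.swap, subst (2) sum.swap) (rule refl)
  also have "\<dots> = (\<Sum>g\<in>?C. \<Sum>h\<in>?C. Q g * Q h * real (card (invariants X \<phi> (inv\<^bsub>G\<^esub> h \<otimes>\<^bsub>G\<^esub> g))))"
  proof (intro sum.cong refl)
    fix g h assume g: "g \<in> ?C" and h: "h \<in> ?C"
    have "\<phi> (inv\<^bsub>G\<^esub> h \<otimes>\<^bsub>G\<^esub> g) x = x \<longleftrightarrow> \<phi> g x = \<phi> h x" if x: "x \<in> X" for x
    proof
      assume "\<phi> (inv\<^bsub>G\<^esub> h \<otimes>\<^bsub>G\<^esub> g) x = x"
      then have "\<phi> h x = \<phi> (h \<otimes>\<^bsub>G\<^esub> (inv\<^bsub>G\<^esub> h \<otimes>\<^bsub>G\<^esub> g)) x"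
        using composition_rule[OF x h] g h by simp
      then show "\<phi> g x = \<phi> h x"
        using g h by (simp add: m_assoc[symmetric])
    next
      assume "\<phi> g x = \<phi> h x"
      then show "\<phi> (inv\<^bsub>G\<^esub> h \<otimes>\<^bsub>G\<^esub> g) x = x"
        using g h x by (simp add: composition_rule orbit_sym_aux)
    qed
    then have "invariants X \<phi> (inv\<^bsub>G\<^esub> h \<otimes>\<^bsub>G\<^esub> g) = {x \<in> X. \<phi> g x = \<phi> h x}"
      by (auto simp: invariants_def)
    then show "(\<Sum>x\<in>X. if \<phi> g x = \<phi> h x then Q g * Q h else 0)
        = Q g * Q h * real (card (invariants X \<phi> (inv\<^bsub>G\<^esub> h \<otimes>\<^bsub>G\<^esub> g)))"
      using fin by (simp add: sum.If_cases Int_def)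
  qed
  finally show ?thesis .
qed

section \<open>The trivial representation and the uniform distribution\<close>

lemma frob_sq_fourier_trivial:
  assumes "trivial_mat_rep G d \<rho>" "(\<Sum>g\<in>carrier G. Q g) = 1"
  shows "frob_sq d (fourier G Q \<rho>) = 1"
proof -
  have "fourier G Q \<rho> 0 0 = of_real (\<Sum>g\<in>carrier G. Q g)"
    using assms(1) by (simp add: fourier_def trivial_mat_rep_def)
  then show ?thesis
    using assms by (simp add: frob_sq_def trivial_mat_rep_def)
qed

text \<open>The averaged matrix projects onto the vectors fixed by \<open>G\<close>, an invariant subspace.\<close>
lemma frob_sq_fourier_uniform_nontrivial:
  assumes grp: "group G" and finG: "finite (carrier G)"
    and u: "unitary_mat_rep G d \<rho>" and irr: "irreducible_rep G (vecs {..<d}) (mat_rep_action d \<rho>)"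
    and nontriv: "\<not> trivial_mat_rep G d \<rho>"
  shows "frob_sq d (fourier G (\<lambda>_. 1 / real (card (carrier G))) \<rho>) = 0"
proof -
  interpret group G by fact
  let ?C = "carrier G" and ?V = "vecs {..<d} :: (nat \<Rightarrow> complex) set" and ?T = "mat_rep_action d \<rho>"
  define A where "A = fourier G (\<lambda>_. 1 / real (card ?C)) \<rho>"
  have rep: "is_rep G ?V ?T"
    and min: "\<And>W. invariant_subspace G ?V ?T W \<Longrightarrow> W = {0} \<or> W = ?V"
    using irr by (auto simp: irreducible_rep_def)
  note R = is_repD[OF rep]
  define F where "F = {v \<in> ?V. \<forall>g\<in>?C. ?T g v = v}"
  have "csubspace F"
    unfolding csubspace_def F_def
    by (auto simp: csubspace_zero[OF R(1)] csubspace_add[OF R(1)] csubspace_csmult[OF R(1)]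
        clinear_on_zero[OF R(2) R(1)] clinear_on_add[OF R(2)] clinear_on_csmult[OF R(2)])
  then have "invariant_subspace G ?V ?T F"
    by (auto simp: invariant_subspace_def F_def)
  then consider "F = {0}" | "F = ?V"
    using min by blast
  then have "A i j = 0" if ij: "i < d" "j < d" for i j
  proof cases
    case 1
    \<comment> \<open>Column \<open>j\<close> of the averaged matrix. Left translation permutes the
      group sum, so every \<open>\<rho> h\<close> fixes the column, which therefore lies in
      \<open>F\<close>.\<close>
    define a where "a = (\<lambda>i. if i < d then A i j else 0)"
    have inv: "(\<Sum>m<d. \<rho> h l m * A m j) = A l j" if h: "h \<in> ?C" and l: "l < d" for h l
    proof -
      have "(\<Sum>m<d. \<rho> h l m * A m j) = (\<Sum>m<d. \<Sum>g\<in>?C. of_real (1 / real (card ?C)) * (\<rho> h l m * \<rho> g m j))"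
        unfolding A_def fourier_def sum_distrib_left by (intro sum.cong refl) simp
      also have "\<dots> = (\<Sum>g\<in>?C. of_real (1 / real (card ?C)) * (\<Sum>m<d. \<rho> h l m * \<rho> g m j))"
        by (subst sum.swap) (simp add: sum_distrib_left)
      also have "\<dots> = (\<Sum>g\<in>?C. of_real (1 / real (card ?C)) * \<rho> (h \<otimes>\<^bsub>G\<^esub> g) l j)"
        using u h l ij by (intro sum.cong refl) (simp add: unitary_mat_rep_def)
      also have "\<dots> = (\<Sum>g\<in>?C. of_real (1 / real (card ?C)) * \<rho> g l j)"
        using h by (intro sum.reindex_bij_betw[of "\<lambda>g. h \<otimes>\<^bsub>G\<^esub> g" _ _ "\<lambda>g. of_real (1 / real (card ?C)) * \<rho> g l j"]
            bij_betwI[where g="\<lambda>g. inv\<^bsub>G\<^esub> h \<otimes>\<^bsub>G\<^esub> g"]) (auto simp: m_assoc[symmetric])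
      finally show ?thesis
        by (simp add: A_def fourier_def)
    qed
    have "?T h a = a" if "h \<in> ?C" for h
      using inv[OF that] by (auto simp: mat_rep_action_def mat_act_def a_def fun_eq_iff)
    then have "a \<in> F"
      by (auto simp: F_def vecs_def a_def)
    then have "a = 0"
      using 1 by blast
    then show ?thesis
      using ij by (metis a_def zero_fun_def)
  next
    case 2
    have d: "0 < d"
      using u by (simp add: unitary_mat_rep_def)
    have b0: "basis_vec 0 \<in> ?V"
      using d by (intro basis_vec_in_vecs) simp
    \<comment> \<open>When all vectors are fixed, every line is invariant. Irreducibility makes this
      one the whole space, so \<open>d = 1\<close> and the representation is trivial, a
      contradiction.\<close>
    define W where "W = {csmult c (basis_vec (0::nat)) | c. True}"
    have WV: "W \<subseteq> ?V"
      using csubspace_csmult[OF R(1) b0] by (auto simp: W_def)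
    have "csubspace W"
      unfolding csubspace_def W_def
      by (auto simp: cvec.scale_left_distrib[symmetric] intro: exI[of _ 0])
    moreover have "?T g ` W \<subseteq> W" if "g \<in> ?C" for g
    proof -
      have "?T g w = w" if "w \<in> W" for w
        using that \<open>g \<in> ?C\<close> WV 2 by (auto simp: F_def)
      then show ?thesis
        by auto
    qed
    ultimately have "W = {0} \<or> W = ?V"
      using WV min by (auto simp: invariant_subspace_def)
    moreover have "basis_vec 0 \<in> W"
      unfolding W_def by (rule CollectI, rule exI[of _ 1]) simp
    moreover have "basis_vec (0::nat) \<noteq> 0"
      by (auto simp: basis_vec_def fun_eq_iff)
    ultimately have "W = ?V"
      by blast
    have "d = 1"
    proof (rule ccontr)
      assume "d \<noteq> 1"
      then have "basis_vec 1 \<in> W"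
        using d \<open>W = ?V\<close> by (simp add: basis_vec_in_vecs)
      then obtain c where "basis_vec 1 = csmult c (basis_vec (0::nat))"
        by (auto simp: W_def)
      from fun_cong[OF this, of 1] show False
        by (simp add: basis_vec_def csmult_def)
    qed
    moreover have "\<rho> g 0 0 = 1" if "g \<in> ?C" for g
    proof -
      have "?T g (basis_vec 0) = basis_vec 0"
        using b0 2 that by (auto simp: F_def)
      from fun_cong[OF this, of 0] show ?thesis
        using \<open>d = 1\<close> by (simp add: mat_rep_action_def mat_act_def basis_vec_def)
    qed
    ultimately show ?thesis
      using nontriv by (simp add: trivial_mat_rep_def)
  qed
  then show ?thesis
    by (simp add: frob_sq_def A_def)
qed

text \<open>By transitivity, left multiplication by an element carrying \<open>z\<close> to
  \<open>y\<close> maps \<open>F z\<close> bijectively onto \<open>F y\<close>. The group is thus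
  cut into \<open>card X\<close> classes of equal size.\<close>

lemma alg_act_uniform:
  assumes act: "transitive_action G X \<phi>" and finG: "finite (carrier G)" and fin: "finite X" and x: "x \<in> X" and y: "y \<in> X"
  shows "alg_act G X \<phi> (\<lambda>_. 1 / real (card (carrier G))) (basis_vec x) y = 1 / of_nat (card X)"
proof -
  interpret transitive_action G X \<phi> by fact
  interpret group G
    using group_hom group_hom.axioms(1) by auto
  let ?C = "carrier G"
  define F where "F z = {g \<in> ?C. \<phi> g x = z}" for z
  have "card (F z) = card (F y)" if z: "z \<in> X" for z
  proof -
    obtain h where h: "h \<in> ?C" "\<phi> h z = y"
      using unique_orbit[OF z y] by blast
    have hi: "\<phi> (inv\<^bsub>G\<^esub> h) y = z"
      using orbit_sym_aux[OF h(1) z h(2)] .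
    have "bij_betw (\<lambda>g. h \<otimes>\<^bsub>G\<^esub> g) (F z) (F y)"
      using h hi x by (intro bij_betwI[where g="\<lambda>g. inv\<^bsub>G\<^esub> h \<otimes>\<^bsub>G\<^esub> g"])
        (auto simp: F_def m_assoc[symmetric] composition_rule)
    then show ?thesis
      by (rule bij_betw_same_card)
  qed
  then have "(\<Sum>z\<in>X. card (F z)) = card X * card (F y)"
    by simp
  moreover have "(\<Sum>z\<in>X. card (F z)) = card ?C"
  proof -
    have "card ?C = (\<Sum>g\<in>?C. 1)"
      by simp
    also have "\<dots> = (\<Sum>z\<in>X. \<Sum>g\<in>{g\<in>?C. \<phi> g x = z}. 1)"
      using element_image x by (intro sum.group[symmetric] finG fin) blast
    finally show ?thesis
      by (simp add: F_def)
  qed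
  ultimately have eq: "card ?C = card X * card (F y)"
    by simp
  have "0 < card ?C"
    using finG by (auto simp: card_gt_0_iff)
  then have "real (card (F y)) / real (card ?C) = 1 / real (card X)"
    by (auto simp: eq field_simps)
  moreover have "(\<Sum>g\<in>?C. if \<phi> g x = y then 1 / real (card ?C) else 0) = real (card (F y)) / real (card ?C)"
    using finG by (simp add: sum.If_cases F_def Int_def)
  ultimately show ?thesis
    unfolding alg_act_basis_vec[OF fin x] by (metis of_real_1 of_real_divide of_real_of_nat_eq)
qed

text \<open>The first bound is that the l2 norm is at most the l1 norm, the second is Cauchy-Schwarz
  against the constant function 1. The factor 1/4 is the square of the 1/2 in
  \<open>tv_norm\<close>.\<close>

lemma tv_norm_bounds:
  assumes "finite X"
  shows "(l2_norm X h)\<^sup>2 / 4 \<le> (tv_norm X h)\<^sup>2"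
    and "(tv_norm X h)\<^sup>2 \<le> real (card X) / 4 * (l2_norm X h)\<^sup>2"
proof -
  let ?s = "\<Sum>x\<in>X. cmod (h x)"
  have tv: "(tv_norm X h)\<^sup>2 = ?s\<^sup>2 / 4"
    by (simp add: tv_norm_def power_divide)
  have l2: "(l2_norm X h)\<^sup>2 = (\<Sum>x\<in>X. (cmod (h x))\<^sup>2)"
    by (simp add: l2_norm_def sum_nonneg)
  have "l2_norm X h \<le> ?s"
    using L2_set_le_sum[of X "\<lambda>x. cmod (h x)"] by (simp add: l2_norm_def L2_set_def)
  moreover have "0 \<le> l2_norm X h"
    by (simp add: l2_norm_def sum_nonneg)
  ultimately show "(l2_norm X h)\<^sup>2 / 4 \<le> (tv_norm X h)\<^sup>2"
    unfolding tv by (simp add: power_mono)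
  have "?s\<^sup>2 \<le> (\<Sum>x\<in>X. (cmod (h x))\<^sup>2) * real (card X)"
    by (rule sum_squared_le_sum_of_squares)
  then show "(tv_norm X h)\<^sup>2 \<le> real (card X) / 4 * (l2_norm X h)\<^sup>2"
    unfolding tv l2 by (simp add: mult.commute)
qed

text \<open>Pythagoras: the coefficients sum to 1, so \<open>unif X\<close> is the orthogonal
  projection of the vector onto the constants, and its squared norm is
  \<open>1 / card X\<close>.\<close>

lemma l2_norm_diff_unif:
  assumes act: "group_action G X \<phi>" and fin: "finite X" and x: "x \<in> X" and Qsum: "(\<Sum>g\<in>carrier G. Q g) = 1"
  shows "(l2_norm X (alg_act G X \<phi> Q (basis_vec x) - unif X))\<^sup>2
    = (l2_norm X (alg_act G X \<phi> Q (basis_vec x)))\<^sup>2 - 1 / real (card X)"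
proof -
  interpret group_action G X \<phi> by fact
  define a where "a y = (\<Sum>g\<in>carrier G. if \<phi> g x = y then Q g else 0)" for y
  have "(\<Sum>y\<in>X. a y) = (\<Sum>g\<in>carrier G. \<Sum>y\<in>X. if \<phi> g x = y then Q g else 0)"
    unfolding a_def by (rule sum.swap)
  also have "\<dots> = (\<Sum>g\<in>carrier G. Q g)"
    using element_image x fin by (intro sum.cong refl) (auto simp: sum.delta)
  finally have asum: "(\<Sum>y\<in>X. a y) = 1"
    using Qsum by simp
  have N: "real (card X) \<noteq> 0"
    using fin x by auto
  have "cmod ((alg_act G X \<phi> Q (basis_vec x) - unif X) y) = \<bar>a y - 1 / real (card X)\<bar>" if "y \<in> X" for y
  proof -
    have "(alg_act G X \<phi> Q (basis_vec x) - unif X) y = of_real (a y - 1 / real (card X))"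
      using that by (simp add: alg_act_basis_vec[OF fin x] a_def unif_def)
    then show ?thesis
      by (simp only: norm_of_real)
  qed
  then have "(l2_norm X (alg_act G X \<phi> Q (basis_vec x) - unif X))\<^sup>2 = (\<Sum>y\<in>X. (a y - 1 / real (card X))\<^sup>2)"
    by (simp add: l2_norm_def sum_nonneg)
  also have "\<dots> = (\<Sum>y\<in>X. (a y)\<^sup>2 + 1 / (real (card X))\<^sup>2 - 2 / real (card X) * a y)"
    by (intro sum.cong refl) (simp add: power2_diff power_divide)
  also have "\<dots> = (\<Sum>y\<in>X. (a y)\<^sup>2) - 1 / real (card X)"
    unfolding sum.distrib sum_subtractf sum_distrib_left[symmetric] asum
    using N by (simp add: power2_eq_square)
  also have "(\<Sum>y\<in>X. (a y)\<^sup>2) = (l2_norm X (alg_act G X \<phi> Q (basis_vec x)))\<^sup>2"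
    unfolding l2_norm_def by (simp add: sum_nonneg alg_act_basis_vec[OF fin x] a_def del: of_real_sum)
  finally show ?thesis .
qed

theorem theorem1p1:
  fixes G :: "'g monoid" and X :: "'x set" and \<phi> :: "'g \<Rightarrow> 'x \<Rightarrow> 'x"
    and k :: nat and d :: "nat \<Rightarrow> nat" and \<rho> :: "nat \<Rightarrow> 'g \<Rightarrow> nat \<Rightarrow> nat \<Rightarrow> complex"
    and Q :: "'g \<Rightarrow> real"
  assumes grp: "group G" and finG: "finite (carrier G)"
    and reps: "\<And>j. j < k \<Longrightarrow> unitary_mat_rep G (d j) (\<rho> j)"
    and irred: "\<And>j. j < k \<Longrightarrow> irreducible_rep G (vecs {..<d j}) (mat_rep_action (d j) (\<rho> j))"
    and noniso: "\<And>i j. i < k \<Longrightarrow> j < k \<Longrightarrow> i \<noteq> j \<Longrightarrow>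
        \<not> rep_iso G (vecs {..<d i}) (mat_rep_action (d i) (\<rho> i)) (vecs {..<d j}) (mat_rep_action (d j) (\<rho> j))"
    and complete: "\<And>(V :: (nat \<Rightarrow> complex) set) T. irreducible_rep G V T \<Longrightarrow>
        \<exists>j<k. rep_iso G V T (vecs {..<d j}) (mat_rep_action (d j) (\<rho> j))"
    and act: "transitive_action G X \<phi>" and finX: "finite X" and neX: "X \<noteq> {}"
    and Qnn: "\<And>g. g \<in> carrier G \<Longrightarrow> Q g \<ge> 0" and Qsum: "(\<Sum>g\<in>carrier G. Q g) = 1"
  shows
   "let S = (1 / real (card X)) * (\<Sum>x\<in>X. (tv_norm X (alg_act G X \<phi> Q (basis_vec x) - unif X))\<^sup>2);
        R = (\<Sum>j\<in>{j. j < k \<and> \<not> trivial_mat_rep G (d j) (\<rho> j)}.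
               real (multiplicity G (vecs {..<d j}) (mat_rep_action (d j) (\<rho> j)) (vecs X) (perm_act X \<phi>))
               * frob_sq (d j) (fourier G Q (\<rho> j)))
    in S \<le> R / 4 \<and> S \<ge> R / (4 * real (card X))
       \<and> ((\<exists>c. \<forall>x\<in>X. l2_norm X (alg_act G X \<phi> Q (basis_vec x)) = c) \<longrightarrow>
            (\<forall>x\<in>X. R / (4 * real (card X)) \<le> (tv_norm X (alg_act G X \<phi> Q (basis_vec x) - unif X))\<^sup>2
                   \<and> (tv_norm X (alg_act G X \<phi> Q (basis_vec x) - unif X))\<^sup>2 \<le> R / 4))"

proof -
  interpret act: transitive_action G X \<phi> by fact
  have ga: "group_action G X \<phi>"
    by (rule act.group_action_axioms)
  interpret group G by fact
  define m where "m j = real (multiplicity G (vecs {..<d j}) (mat_rep_action (d j) (\<rho> j)) (vecs X) (perm_act X \<phi>))" for j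
  define n where "n = real (card X)"
  define triv where "triv = {j. j < k \<and> trivial_mat_rep G (d j) (\<rho> j)}"
  define nontriv where "nontriv = {j. j < k \<and> \<not> trivial_mat_rep G (d j) (\<rho> j)}"
  define frob where "frob q j = frob_sq (d j) (fourier G q (\<rho> j))" for q :: "'g \<Rightarrow> real" and j
  define L where "L q x = (l2_norm X (alg_act G X \<phi> q (basis_vec x)))\<^sup>2" for q x
  define D where "D x = alg_act G X \<phi> Q (basis_vec x) - unif X" for x
  define R where "R = (\<Sum>j\<in>nontriv. m j * frob Q j)"
  have n: "n > 0"
    using finX neX by (simp add: n_def card_gt_0_iff)
  \<comment> \<open>Stated for every real weight \<open>q\<close>, since it is applied both to
    \<open>Q\<close> and to the uniform distribution. Characters are complex, so the computation
    runs in \<complex> and returns to the reals at the end.\<close>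
  have plancherel: "(\<Sum>x\<in>X. L q x) = (\<Sum>j<k. m j * frob q j)" for q
  proof -
    let ?C = "carrier G"
    have "complex_of_real (\<Sum>x\<in>X. L q x) = (\<Sum>g\<in>?C. \<Sum>h\<in>?C. of_real (q g * q h)
        * of_nat (card (invariants X \<phi> (inv\<^bsub>G\<^esub> h \<otimes>\<^bsub>G\<^esub> g))))"
      unfolding L_def sum_l2_norm_alg_act[OF ga finX] by simp
    also have "\<dots> = (\<Sum>g\<in>?C. \<Sum>h\<in>?C. \<Sum>j<k. of_real (m j) * (of_real (q g * q h)
        * (\<Sum>i<d j. \<rho> j (inv\<^bsub>G\<^esub> h \<otimes>\<^bsub>G\<^esub> g) i i)))"
    proof (intro sum.cong refl)
      fix g h assume gh: "g \<in> ?C" "h \<in> ?C"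
      have "of_nat (card (invariants X \<phi> (inv\<^bsub>G\<^esub> h \<otimes>\<^bsub>G\<^esub> g)))
          = (\<Sum>j<k. of_real (m j) * (\<Sum>i<d j. \<rho> j (inv\<^bsub>G\<^esub> h \<otimes>\<^bsub>G\<^esub> g) i i))"
        unfolding m_def of_real_of_nat_eq
        by (rule perm_character_decomposition[OF grp finG irred noniso complete ga finX]) (use gh in auto)
      then show "of_real (q g * q h) * of_nat (card (invariants X \<phi> (inv\<^bsub>G\<^esub> h \<otimes>\<^bsub>G\<^esub> g)))
          = (\<Sum>j<k. of_real (m j) * (of_real (q g * q h) * (\<Sum>i<d j. \<rho> j (inv\<^bsub>G\<^esub> h \<otimes>\<^bsub>G\<^esub> g) i i)))"
        by (simp only: sum_distrib_left mult.left_commute)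
    qed
    also have "\<dots> = (\<Sum>j<k. \<Sum>g\<in>?C. \<Sum>h\<in>?C. of_real (m j) * (of_real (q g * q h)
        * (\<Sum>i<d j. \<rho> j (inv\<^bsub>G\<^esub> h \<otimes>\<^bsub>G\<^esub> g) i i)))"
      by (subst (2) sum.swap, subst sum.swap) (rule refl)
    also have "\<dots> = (\<Sum>j<k. of_real (m j) * of_real (frob q j))"
    proof (intro sum.cong refl)
      fix j assume "j \<in> {..<k}"
      then have u: "unitary_mat_rep G (d j) (\<rho> j)"
        using reps by simp
      show "(\<Sum>g\<in>?C. \<Sum>h\<in>?C. of_real (m j) * (of_real (q g * q h)
          * (\<Sum>i<d j. \<rho> j (inv\<^bsub>G\<^esub> h \<otimes>\<^bsub>G\<^esub> g) i i))) = of_real (m j) * of_real (frob q j)"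
        unfolding frob_def frob_sq_fourier[OF grp u] by (simp only: sum_distrib_left)
    qed
    finally show ?thesis
      by (metis (no_types, lifting) of_real_eq_iff of_real_mult of_real_sum sum.cong)
  qed
  have split: "(\<Sum>j<k. f j) = (\<Sum>j\<in>triv. f j) + (\<Sum>j\<in>nontriv. f j)" for f :: "nat \<Rightarrow> real"
  proof -
    have "{..<k} = triv \<union> nontriv" "triv \<inter> nontriv = {}" "finite triv" "finite nontriv"
      by (auto simp: triv_def nontriv_def)
    then show ?thesis
      by (simp add: sum.union_disjoint)
  qed
  \<comment> \<open>Apply \<open>plancherel\<close> to the uniform distribution, whose Fourier transform vanishes at nontrivial
    representations; no analysis of the decomposition of \<open>\<complex>X\<close> is needed.\<close>
  have mtriv: "(\<Sum>j\<in>triv. m j) = 1"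
  proof -
    define u where "u = (\<lambda>_::'g. 1 / real (card (carrier G)))"
    have usum: "(\<Sum>g\<in>carrier G. u g) = 1"
      using finG one_closed by (auto simp: u_def)
    \<comment> \<open>Transitivity makes every coefficient equal to \<open>1 / n\<close>; there are
      \<open>n\<close> of them.\<close>
    have "L u x = 1 / n" if x: "x \<in> X" for x
    proof -
      have "L u x = (\<Sum>y\<in>X. (1 / n)\<^sup>2)"
        unfolding L_def l2_norm_def u_def
        by (simp add: sum_nonneg alg_act_uniform[OF act finG finX x] norm_divide n_def)
      then show ?thesis
        using n by (simp add: n_def power2_eq_square)
    qed
    then have "(\<Sum>x\<in>X. L u x) = 1"
      using n by (simp add: n_def)
    then have "1 = (\<Sum>j\<in>triv. m j * frob u j) + (\<Sum>j\<in>nontriv. m j * frob u j)"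
      using plancherel split by simp
    also have "(\<Sum>j\<in>triv. m j * frob u j) = (\<Sum>j\<in>triv. m j)"
      by (intro sum.cong refl) (simp add: frob_def triv_def frob_sq_fourier_trivial usum)
    also have "(\<Sum>j\<in>nontriv. m j * frob u j) = 0"
      by (intro sum.neutral ballI) (simp add: frob_def nontriv_def u_def
          frob_sq_fourier_uniform_nontrivial[OF grp finG reps irred])
    finally show ?thesis
      by simp
  qed
  have "(\<Sum>j\<in>triv. m j * frob Q j) = (\<Sum>j\<in>triv. m j)"
    by (intro sum.cong refl) (simp add: frob_def triv_def frob_sq_fourier_trivial Qsum)
  \<comment> \<open>The trivial part contributes its total multiplicity times the squared mass of
    \<open>Q\<close>, which is \<open>1\<close>.\<close>
  then have LR: "(\<Sum>x\<in>X. L Q x) = R + 1"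
    using plancherel split mtriv by (simp add: R_def)
  have DL: "(l2_norm X (D x))\<^sup>2 = L Q x - 1 / n" if "x \<in> X" for x
    unfolding D_def L_def n_def by (rule l2_norm_diff_unif[OF ga finX that Qsum])
  \<comment> \<open>Subtracting \<open>1 / n\<close> at each of the \<open>n\<close> points removes
    exactly the trivial contribution.\<close>
  have DR: "(\<Sum>x\<in>X. (l2_norm X (D x))\<^sup>2) = R"
    using n by (simp add: DL sum_subtractf LR n_def)

  \<comment> \<open>From l2 norms to total variation\<close>
  have lower: "(l2_norm X (D x))\<^sup>2 / 4 \<le> (tv_norm X (D x))\<^sup>2"
    and upper: "(tv_norm X (D x))\<^sup>2 \<le> n / 4 * (l2_norm X (D x))\<^sup>2" for x
    unfolding n_def by (rule tv_norm_bounds[OF finX])+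
  have "(\<Sum>x\<in>X. (tv_norm X (D x))\<^sup>2) \<le> n / 4 * R"
    unfolding DR[symmetric] sum_distrib_left by (intro sum_mono upper)
  then have S_upper: "(1 / n) * (\<Sum>x\<in>X. (tv_norm X (D x))\<^sup>2) \<le> R / 4"
    using n by (simp add: field_simps)
  have "R / 4 \<le> (\<Sum>x\<in>X. (tv_norm X (D x))\<^sup>2)"
    unfolding DR[symmetric] sum_divide_distrib by (intro sum_mono lower)
  then have S_lower: "R / (4 * n) \<le> (1 / n) * (\<Sum>x\<in>X. (tv_norm X (D x))\<^sup>2)"
    using n by (simp add: field_simps)
  \<comment> \<open>If the norms agree at all points, then by \<open>DL\<close> so do those of the
    \<open>D x\<close>, and each square equals its average \<open>R / n\<close>. The norm comparison
    then applies at a single point.\<close>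
  have pointwise: "R / (4 * n) \<le> (tv_norm X (D x))\<^sup>2 \<and> (tv_norm X (D x))\<^sup>2 \<le> R / 4"
    if c: "\<forall>x\<in>X. l2_norm X (alg_act G X \<phi> Q (basis_vec x)) = c" and x: "x \<in> X" for c x
  proof -
    have "(l2_norm X (D z))\<^sup>2 = (l2_norm X (D x))\<^sup>2" if "z \<in> X" for z
      using that x c by (simp add: DL L_def)
    then have "R = n * (l2_norm X (D x))\<^sup>2"
      unfolding DR[symmetric] n_def by simp
    then show ?thesis
      using lower[of x] upper[of x] n by (simp add: field_simps)
  qed
  show ?thesis
    unfolding Let_def D_def[symmetric] n_def[symmetric] m_def[symmetric] frob_def[symmetric]
      nontriv_def[symmetric] R_def[symmetric]
    using S_upper S_lower pointwise by blast
qed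

end
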